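(* Let $U,V$ be subspaces of $\mathbb{R}^n$ with $1\le p:=\dim U\le q:=\dim V\le n-1$, let $s:=\dim(U\cap V)$, and let $\theta_1\le\dots\le\theta_p$ be the principal angles between $U$ and $V$, where $\theta_{s+1}=\theta_F$ is the Friedrichs angle. For $\mu\in\mathbb{R}$ let $S_\mu:=P_U((1-\mu)\mathrm{Id}+\mu P_V)=(1-\mu)P_U+\mu P_UP_V$. Then $S_\mu$ is convergent if and only if $\mu\in\left[0,\frac{2}{\sin^2\theta_p}\right)$, with the convention $\frac10=\infty$. Moreover, the following assertions hold: (i) If $\mu\in\left(0,\frac{2}{\sin^2\theta_{s+1}+\sin^2\theta_p}\right]$, then $S_\mu$ is convergent to $P_{U\cap V}$ with the optimal convergence rate $\gamma(S_\mu)=1-\mu\sin^2\theta_{s+1}$. (ii) If $\mu\in\left(\frac{2}{\sin^2\theta_{s+1}+\sin^2\theta_p},\frac{2}{\sin^2\theta_p}\right)$, then $S_\mu$ is convergent to $P_{U\cap V}$ with the optimal convergence rate $\gamma(S_\mu)=\mu\sin^2\theta_p-1$. Consequently, when $\mu\neq0$, $S_\mu$ is convergent to $P_{U\cap V}$ with the optimal convergence rate smaller than $\cos^2\theta_{s+1}=c_F^2(U,V)$ if and only if $\mu\in\left(1,\frac{2-\sin^2\theta_{s+1}}{\sin^2\theta_p}\right)$. Furthermore, $S_\mu$ attains the smallest convergence rate $\frac{\sin^2\theta_p-\sin^2\theta_{s+1}}{\sin^2\theta_{s+1}+\sin^2\theta_p}$ at $\mu=\frac{2}{\sin^2\theta_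{s+1}+\sin^2\theta_p}$.
   Context: $P_W$ denotes the orthogonal projection onto a subspace $W$ of $\mathbb{R}^n$, $W^\perp$ is the orthogonal complement of $W$, $\mathrm{Id}$ is the identity, and $\|\cdot\|$ applied to matrices is the operator norm. A matrix $A$ is convergent to $A^\infty$ if $\|A^k-A^\infty\|\to0$ as $k\to\infty$; it is convergent if such a limit exists. It is (linearly) convergent to $A^\infty$ with rate $r\in[0,1)$ if there are $M,N>0$ such that $\|A^k-A^\infty\|\le M r^k$ for all $k\in\mathbb{N}$, $k>N$; if the infimum of all such rates is itself a rate, it is called the optimal convergence rate. $\gamma(A):=\max\{|\lambda|:\lambda\in(\{0\}\cup\sigma(A))\setminus\{1\}\}$, where $\sigma(A)$ is the set of eigenvalues of $A$. The principal angles $\theta_1\le\dots\le\theta_p$ in $[0,\frac{\pi}{2}]$ between $U$ and $V$ are defined recursively by $\cos\theta_k:=\langle u_k,v_k\rangle=\max\{\langle u,v\rangle: u\in U, v\in V, \|u\|=\|v\|=1, \langle u,u_j\rangle=\langle v,v_j\rangle=0 \text{ for } j=1,\dots,k-1\}$, where $(u_k,v_k)$ is a maximizing pair; the angles do not depend on the choice of maximizers. The Friedrichs angle $\theta_F\in(0,\frac{\pi}{2}]$ between $U$ and $V$ is the angle whose cosine is $c_F(U,V):=\max\{\langle u,v\rangle: u\in U\cap(U\cap V)^\perp, v\in V\cap(U\cap V)^\perp,\|u\|=\|v\|=1\}$. One has $\theta_k=0$ for $k=1,\dots,s$ and $\theta_{s+1}=\theta_F>0$.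
   Formalization: If U is contained in V (s=p), S_μ=P_U converges for every μ and θ_{s+1} is undefined; so the equivalence is stated for all μ if s<p and for μ≥0 if s=p, the claims involving θ_{s+1} only if s<p, and the smallest rate is taken over μ≠0. *)

theory Defs
  imports "HOL-Analysis.Analysis"
begin

definition proj_matrix :: "(real^'n) set \<Rightarrow> real^'n^'n" where
  "proj_matrix W = matrix (\<lambda>x. THE y. y \<in> W \<and> x - y \<in> W\<^sup>\<bottom>)"

(* The operations * and ^ of the class instances for vec act componentwise on matrices,
   so powers are defined here from the matrix product. *)
primrec mat_power :: "real^'n^'n \<Rightarrow> nat \<Rightarrow> real^'n^'n" where
  "mat_power A 0 = mat 1"
| "mat_power A (Suc k) = A ** mat_power A k"

definition op_norm :: "real^'n^'n \<Rightarrow> real" where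
  "op_norm A = onorm (\<lambda>x. A *v x)"

definition convergent_mat_to :: "real^'n^'n \<Rightarrow> real^'n^'n \<Rightarrow> bool" where
  "convergent_mat_to A L \<longleftrightarrow> (\<lambda>k. op_norm (mat_power A k - L)) \<longlonglongrightarrow> 0"

definition convergent_mat :: "real^'n^'n \<Rightarrow> bool" where
  "convergent_mat A \<longleftrightarrow> (\<exists>L. convergent_mat_to A L)"

definition convergence_rate :: "real^'n^'n \<Rightarrow> real^'n^'n \<Rightarrow> real \<Rightarrow> bool" where
  "convergence_rate A L r \<longleftrightarrow> r \<in> {0..<1} \<and>
     (\<exists>M::real. \<exists>N::nat. M > 0 \<and> N > 0 \<and>
        (\<forall>k>N. op_norm (mat_power A k - L) \<le> M * r ^ k))"

definition optimal_convergence_rate :: "real^'n^'n \<Rightarrow> real^'n^'n \<Rightarrow> real \<Rightarrow> bool" where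
  "optimal_convergence_rate A L r \<longleftrightarrow>
     convergence_rate A L r \<and> r = Inf {r'. convergence_rate A L r'}"

(* Eigenvalues of a real matrix are taken over the complex numbers. *)
definition eigenvalues :: "real^'n^'n \<Rightarrow> complex set" where
  "eigenvalues A = {c. \<exists>x::complex^'n. x \<noteq> 0 \<and> map_matrix complex_of_real A *v x = c *s x}"

definition gamma_mat :: "real^'n^'n \<Rightarrow> real" where
  "gamma_mat A = Max (cmod ` (({0} \<union> eigenvalues A) - {1}))"

(* The pairs that are admissible in the k-th step of the recursion for the principal angles,
   given the maximizers (u j, v j) chosen in the steps j = 1, ..., k - 1. *)
definition principal_pairs ::
  "'a::euclidean_space set \<Rightarrow> 'a set \<Rightarrow> (nat \<Rightarrow> 'a) \<Rightarrow> (nat \<Rightarrow> 'a) \<Rightarrow> nat \<Rightarrow> ('a \<times> 'a) set" where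
  "principal_pairs U V u v k =
     {(x, y). x \<in> U \<and> y \<in> V \<and> norm x = 1 \<and> norm y = 1 \<and>
        (\<forall>j\<in>{1..<k}. x \<bullet> u j = 0 \<and> y \<bullet> v j = 0)}"

(* theta 1, theta 2, ... are the principal angles obtained from some choice of maximizers;
   values of theta outside {1..min (dim U) (dim V)} are unconstrained. *)
definition principal_angles ::
  "'a::euclidean_space set \<Rightarrow> 'a set \<Rightarrow> (nat \<Rightarrow> real) \<Rightarrow> bool" where
  "principal_angles U V \<theta> \<longleftrightarrow>
     (\<exists>u v. \<forall>k\<in>{1..min (dim U) (dim V)}.
        \<theta> k \<in> {0..pi/2} \<and>
        (u k, v k) \<in> principal_pairs U V u v k \<and>
        cos (\<theta> k) = u k \<bullet> v k \<and>
        (\<forall>(x, y) \<in> principal_pairs U V u v k. x \<bullet> y \<le> u k \<bullet> v k))"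

(* GREATEST is the maximum; it is attained unless U \<subseteq> V or V \<subseteq> U, in which case there are
   no admissible pairs and the value is unspecified. *)
definition friedrichs_cos :: "'a::euclidean_space set \<Rightarrow> 'a set \<Rightarrow> real" where
  "friedrichs_cos U V =
     (GREATEST c. \<exists>u v. u \<in> U \<inter> (U \<inter> V)\<^sup>\<bottom> \<and> v \<in> V \<inter> (U \<inter> V)\<^sup>\<bottom> \<and>
        norm u = 1 \<and> norm v = 1 \<and> c = u \<bullet> v)"

definition friedrichs_angle :: "'a::euclidean_space set \<Rightarrow> 'a set \<Rightarrow> real" where
  "friedrichs_angle U V = arccos (friedrichs_cos U V)"

definition relaxed_proj :: "(real^'n) set \<Rightarrow> (real^'n) set \<Rightarrow> real \<Rightarrow> real^'n^'n" where
  "relaxed_proj U V \<mu> = proj_matrix U ** ((1 - \<mu>) *\<^sub>R mat 1 + \<mu> *\<^sub>R proj_matrix V)"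

end

theory Submission
  imports Defs
begin

text \<open>
  The operator \<open>S = P\<^sub>U ((1 - \<mu>) Id + \<mu> P\<^sub>V)\<close> is in general not symmetric, but the principal vectors
  diagonalize it explicitly, and everything is read off from that diagonal form.

  The variational definition of the principal angles yields singular vectors. Write
  \<open>c\<^sub>k = cos \<theta>\<^sub>k = u\<^sub>k \<bullet> v\<^sub>k\<close>. Once \<open>u\<^sub>k\<close> is fixed, \<open>v\<^sub>k\<close> maximizes a linear functional on the unit
  sphere of the part of \<open>V\<close> that is orthogonal to the earlier \<open>v\<^sub>j\<close>, so the first-order condition
  says that \<open>u\<^sub>k\<close> and \<open>c\<^sub>k v\<^sub>k\<close> have the same inner products with that part. By induction on \<open>k\<close>
  the earlier \<open>v\<^sub>j\<close> are orthogonal to \<open>u\<^sub>k\<close> too, whence \<open>P\<^sub>V u\<^sub>k = c\<^sub>k v\<^sub>k\<close> and, by symmetry,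
  \<open>P\<^sub>U v\<^sub>k = c\<^sub>k u\<^sub>k\<close> (lemma \<open>singular_vectors\<close>). Since \<open>u\<^sub>1, \<dots>, u\<^sub>p\<close> is an orthonormal basis of
  \<open>U\<close>, this gives
  \<open>S x = \<Sum>\<^sub>i (w\<^sub>i \<bullet> x) u\<^sub>i\<close> with \<open>w\<^sub>i = (1 - \<mu>) u\<^sub>i + \<mu> c\<^sub>i v\<^sub>i\<close>, and
  \<open>w\<^sub>i \<bullet> u\<^sub>j = \<lambda>\<^sub>i \<delta>\<^sub>i\<^sub>j\<close> where \<open>\<lambda>\<^sub>i = 1 - \<mu> (1 - c\<^sub>i\<^sup>2) = 1 - \<mu> sin\<^sup>2 \<theta>\<^sub>i\<close>.

  Such a biorthogonal expansion has the powers
  \<open>S\<^sup>k\<^sup>+\<^sup>1 x = \<Sum>\<^sub>i \<lambda>\<^sub>i\<^sup>k (w\<^sub>i \<bullet> x) u\<^sub>i\<close>, and its eigenvalues are the \<open>\<lambda>\<^sub>i\<close>, up to the eigenvalue 0. Hence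
  the powers converge iff \<open>-1 < \<lambda>\<^sub>i \<le> 1\<close> for all \<open>i\<close>; the limit keeps the summands with
  \<open>\<lambda>\<^sub>i = 1\<close>; and the best rate is the largest \<open>\<bar>\<lambda>\<^sub>i\<bar>\<close> with \<open>\<lambda>\<^sub>i \<noteq> 1\<close>, because no
  other terms occur in the powers and \<open>S\<^sup>k u\<^sub>i = \<lambda>\<^sub>i\<^sup>k u\<^sub>i\<close> shows that no smaller rate is possible (lemmas
  \<open>convergent_iff\<close> and \<open>optimal_rate_gamma\<close>).

  It remains to count. A common vector of \<open>U\<close> and \<open>V\<close> has no component along a \<open>u\<^sub>k\<close> with
  \<open>c\<^sub>k < 1\<close>, and \<open>c\<^sub>k = 1\<close> forces \<open>u\<^sub>k = v\<^sub>k\<close>; so the indices with \<open>sin \<theta>\<^sub>k = 0\<close> are exactly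
  \<open>1, \<dots>, s\<close>, the limit for \<open>\<mu> \<noteq> 0\<close> is \<open>P\<^sub>U\<^sub>\<inter>\<^sub>V\<close>, and the maximization problem for index \<open>s + 1\<close> is the one
  that defines the Friedrichs angle. As \<open>sin\<^sup>2 \<theta>\<^sub>i\<close> increases from \<open>a = sin\<^sup>2 \<theta>\<^sub>s\<^sub>+\<^sub>1\<close> to
  \<open>b = sin\<^sup>2 \<theta>\<^sub>p\<close>, \<open>\<gamma>(S) = max (1 - \<mu> a) (\<mu> b - 1)\<close> for \<open>\<mu> > 0\<close> if \<open>s < p\<close>, and \<open>S\<close> converges for such \<open>\<mu>\<close>
  iff this is less than 1. The claims about rates are
  elementary properties of this function, whose two branches cross at \<open>\<mu> = 2 / (a + b)\<close>.
\<close>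

section \<open>Limits and rates of matrix powers\<close>

lemma op_norm_nonneg: "0 \<le> op_norm A"
  unfolding op_norm_def by (rule onorm_pos_le) simp

lemma convergence_rate_imp_convergent:
  assumes "convergence_rate A L r"
  shows "convergent_mat_to A L"
proof -
  obtain M N where r: "0 \<le> r" "r < 1" and M: "\<And>k. k > N \<Longrightarrow> op_norm (mat_power A k - L) \<le> M * r ^ k"
    using assms unfolding convergence_rate_def by auto
  have "(\<lambda>k. M * r ^ k) \<longlonglongrightarrow> M * 0"
    using r by (intro tendsto_mult tendsto_const LIMSEQ_power_zero) auto
  then have bound: "(\<lambda>k. M * r ^ k) \<longlonglongrightarrow> 0" by simp
  have "\<forall>\<^sub>F k in sequentially. op_norm (mat_power A k - L) \<le> M * r ^ k"
    using eventually_gt_at_top[of N] by eventually_elim (rule M)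
  then show ?thesis
    unfolding convergent_mat_to_def
    by (intro Lim_null_comparison[OF _ bound]) (simp add: op_norm_nonneg)
qed

lemma convergent_mat_to_vector:
  assumes "convergent_mat_to A L"
  shows "(\<lambda>k. mat_power A k *v x) \<longlonglongrightarrow> L *v x"
proof (rule LIM_zero_cancel, rule Lim_null_comparison)
  have "norm (mat_power A k *v x - L *v x) \<le> op_norm (mat_power A k - L) * norm x" for k
    unfolding op_norm_def matrix_vector_mult_diff_rdistrib[symmetric]
    by (rule onorm) simp
  then show "\<forall>\<^sub>F k in sequentially. norm (mat_power A k *v x - L *v x) \<le> op_norm (mat_power A k - L) * norm x"
    by simp
  show "(\<lambda>k. op_norm (mat_power A k - L) * norm x) \<longlonglongrightarrow> 0"
    using assms tendsto_mult_left_zero unfolding convergent_mat_to_def by blast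
qed

lemma convergent_mat_to_unique:
  assumes "convergent_mat_to A L" "convergent_mat_to A L'"
  shows "L = L'"
  using convergent_mat_to_vector[OF assms(1)] convergent_mat_to_vector[OF assms(2)]
  by (auto simp: matrix_eq intro: LIMSEQ_unique)

text \<open>
  If \<open>c \<noteq> 1\<close>, then \<open>c\<^sup>k\<close> is a constant multiple of the difference of consecutive powers, so it
  tends to 0. This excludes \<open>c = -1\<close> along with \<open>\<bar>c\<bar> > 1\<close>.
\<close>
lemma convergent_powers_bounds:
  fixes c :: real
  assumes "convergent (\<lambda>k. c ^ k)"
  shows "-1 < c \<and> c \<le> 1"
proof (cases "c = 1")
  case False
  obtain l where l: "(\<lambda>k. c ^ k) \<longlonglongrightarrow> l" using assms by (auto simp: convergent_def)
  then have "(\<lambda>k. c ^ Suc k - c ^ k) \<longlonglongrightarrow> l - l" by (intro tendsto_diff LIMSEQ_Suc)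
  then have "(\<lambda>k. (c - 1) * c ^ k) \<longlonglongrightarrow> 0" by (simp add: algebra_simps)
  then have "(\<lambda>k. inverse (c - 1) * ((c - 1) * c ^ k)) \<longlonglongrightarrow> 0" by (rule tendsto_mult_right_zero)
  then have "(\<lambda>k. c ^ k) \<longlonglongrightarrow> 0" using False by (simp add: mult.assoc[symmetric])
  then have "\<forall>\<^sub>F k in sequentially. \<bar>c ^ k\<bar> < 1"
    using tendstoD[of "\<lambda>k. c ^ k" 0 sequentially 1] by (simp add: dist_real_def)
  then obtain k where "\<bar>c\<bar> ^ k < 1" by (auto simp: eventually_sequentially power_abs)
  then have "\<bar>c\<bar> < 1" by (meson not_less one_le_power)
  then show ?thesis by auto
qed auto

lemma optimal_convergence_rate_unique:
  "optimal_convergence_rate A L r \<Longrightarrow> optimal_convergence_rate A L r' \<Longrightarrow> r = r'"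
  by (simp add: optimal_convergence_rate_def)

section \<open>Biorthogonal expansions and their spectrum\<close>

text \<open>
  A diagonalization of a matrix that need be neither symmetric nor invertible: the \<open>u i\<close> are
  orthonormal eigenvectors whose span contains the range, and the \<open>w i\<close> are the coordinate functionals of
  the image. The kernel, which the \<open>u i\<close> do not describe, is what the \<open>w i\<close> annihilate; a
  projection followed by a symmetric operator on its range has this form.
\<close>
locale diagonal_expansion =
  fixes A :: "real^'n^'n" and I :: "'i set" and u w :: "'i \<Rightarrow> real^'n" and lam :: "'i \<Rightarrow> real"
  assumes finite_index: "finite I"
    and expansion: "A *v x = (\<Sum>i\<in>I. (w i \<bullet> x) *\<^sub>R u i)"
    and biorthogonal: "i \<in> I \<Longrightarrow> j \<in> I \<Longrightarrow> w i \<bullet> u j = (if i = j then lam i else 0)"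
    and orthonormal: "i \<in> I \<Longrightarrow> j \<in> I \<Longrightarrow> u i \<bullet> u j = (if i = j then 1 else 0)"
begin

text \<open>
  The spectral projection of the eigenvalue 1, which is the limit of the powers if they converge.
\<close>
definition fixed_part :: "real^'n^'n" where
  "fixed_part = matrix (\<lambda>x. \<Sum>i\<in>{i\<in>I. lam i = 1}. (w i \<bullet> x) *\<^sub>R u i)"

lemma fixed_part_apply: "fixed_part *v x = (\<Sum>i\<in>{i\<in>I. lam i = 1}. (w i \<bullet> x) *\<^sub>R u i)"
proof -
  have "linear (\<lambda>x. \<Sum>i\<in>{i\<in>I. lam i = 1}. (w i \<bullet> x) *\<^sub>R u i)"
    by (auto intro!: linearI simp: inner_add_right scaleR_left_distrib sum.distrib scaleR_sum_right)
  then show ?thesis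
    unfolding fixed_part_def by (simp add: matrix_works)
qed

text \<open>
  The exponent lags behind by one because the first factor only produces the coordinates
  \<open>w i \<bullet> x\<close>; each further factor multiplies them by the eigenvalues.
\<close>
lemma mat_power_Suc_apply: "mat_power A (Suc k) *v x = (\<Sum>i\<in>I. (lam i ^ k * (w i \<bullet> x)) *\<^sub>R u i)"
proof (induction k)
  case 0
  show ?case by (simp add: expansion)
next
  case (Suc k)
  have "mat_power A (Suc (Suc k)) *v x = A *v (mat_power A (Suc k) *v x)"
    by (simp add: matrix_vector_mul_assoc)
  also have "\<dots> = (\<Sum>i\<in>I. (\<Sum>j\<in>I. (lam j ^ k * (w j \<bullet> x)) * (w i \<bullet> u j)) *\<^sub>R u i)"
    by (simp only: Suc expansion[of "\<Sum>j\<in>I. _ j *\<^sub>R u j"] inner_sum_right inner_scaleR_right)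
  also have "\<dots> = (\<Sum>i\<in>I. (lam i ^ Suc k * (w i \<bullet> x)) *\<^sub>R u i)"
  proof (rule sum.cong[OF refl])
    fix i assume i: "i \<in> I"
    have "(\<Sum>j\<in>I. (lam j ^ k * (w j \<bullet> x)) * (w i \<bullet> u j))
        = (\<Sum>j\<in>I. if i = j then lam i ^ Suc k * (w i \<bullet> x) else 0)"
      using i by (intro sum.cong) (auto simp: biorthogonal)
    then show "(\<Sum>j\<in>I. (lam j ^ k * (w j \<bullet> x)) * (w i \<bullet> u j)) *\<^sub>R u i = (lam i ^ Suc k * (w i \<bullet> x)) *\<^sub>R u i"
      using i finite_index by (simp add: sum.delta')
  qed
  finally show ?case .
qed

lemma eigenvector:
  assumes "i \<in> I" shows "A *v u i = lam i *\<^sub>R u i"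
proof -
  have "A *v u i = (\<Sum>j\<in>I. if j = i then lam i *\<^sub>R u i else 0)"
    unfolding expansion using assms by (intro sum.cong) (auto simp: biorthogonal)
  then show ?thesis using assms finite_index by simp
qed

lemma mat_power_eigenvector:
  assumes "i \<in> I" shows "mat_power A k *v u i = lam i ^ k *\<^sub>R u i"
proof (induction k)
  case (Suc k)
  have "mat_power A (Suc k) *v u i = A *v (mat_power A k *v u i)"
    by (simp add: matrix_vector_mul_assoc)
  also have "\<dots> = lam i ^ Suc k *\<^sub>R u i"
    by (simp add: Suc matrix_vector_mult_scaleR eigenvector[OF assms])
  finally show ?case .
qed simp

lemma fixed_part_eigenvector:
  assumes "i \<in> I" "lam i \<noteq> 1" shows "fixed_part *v u i = 0"
  unfolding fixed_part_apply using assms by (intro sum.neutral) (auto simp: biorthogonal)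

lemma norm_eigenvector: "i \<in> I \<Longrightarrow> norm (u i) = 1"
  using orthonormal[of i i] by (simp add: norm_eq_1)

lemma eigenvalue_power_le_op_norm:
  assumes i: "i \<in> I" "lam i \<noteq> 1"
  shows "\<bar>lam i\<bar> ^ k \<le> op_norm (mat_power A k - fixed_part)"
proof -
  have "(mat_power A k - fixed_part) *v u i = lam i ^ k *\<^sub>R u i"
    by (simp add: matrix_vector_mult_diff_rdistrib mat_power_eigenvector i fixed_part_eigenvector)
  then have "norm (lam i ^ k *\<^sub>R u i) \<le> op_norm (mat_power A k - fixed_part) * norm (u i)"
    unfolding op_norm_def by (metis matrix_vector_mul_bounded_linear onorm)
  then show ?thesis by (simp add: norm_eigenvector i power_abs)
qed

text \<open>
  Subtracting the limit removes the summands with eigenvalue 1, and the others are bounded by the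
  triangle and Cauchy-Schwarz inequalities.
\<close>
lemma op_norm_power_diff_le:
  assumes "\<And>i. i \<in> I \<Longrightarrow> lam i \<noteq> 1 \<Longrightarrow> \<bar>lam i\<bar> \<le> r" and "0 \<le> r"
  shows "op_norm (mat_power A (Suc k) - fixed_part) \<le> (\<Sum>i\<in>I. norm (w i)) * r ^ k"
  unfolding op_norm_def
proof (rule onorm_le)
  fix x
  have "(mat_power A (Suc k) - fixed_part) *v x
      = (\<Sum>i\<in>I. (lam i ^ k * (w i \<bullet> x)) *\<^sub>R u i) - (\<Sum>i\<in>{i\<in>I. lam i = 1}. (w i \<bullet> x) *\<^sub>R u i)"
    by (simp only: matrix_vector_mult_diff_rdistrib mat_power_Suc_apply fixed_part_apply)
  also have "(\<Sum>i\<in>{i\<in>I. lam i = 1}. (w i \<bullet> x) *\<^sub>R u i) = (\<Sum>i\<in>I. if lam i = 1 then (w i \<bullet> x) *\<^sub>R u i else 0)"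
    using finite_index by (simp add: sum.If_cases Int_def)
  also have "(\<Sum>i\<in>I. (lam i ^ k * (w i \<bullet> x)) *\<^sub>R u i) - \<dots>
      = (\<Sum>i\<in>I. if lam i = 1 then 0 else (lam i ^ k * (w i \<bullet> x)) *\<^sub>R u i)"
    unfolding sum_subtractf[symmetric] by (intro sum.cong) auto
  also have "norm \<dots> \<le> (\<Sum>i\<in>I. norm (w i) * norm x * r ^ k)"
  proof (rule sum_norm_le)
    fix i assume i: "i \<in> I"
    show "norm (if lam i = 1 then 0 else (lam i ^ k * (w i \<bullet> x)) *\<^sub>R u i) \<le> norm (w i) * norm x * r ^ k"
    proof (cases "lam i = 1")
      case True
      then show ?thesis using assms(2) by simp
    next
      case False
      have "\<bar>lam i\<bar> ^ k \<le> r ^ k" using assms(1)[OF i False] by (intro power_mono) auto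
      then have "\<bar>lam i\<bar> ^ k * \<bar>w i \<bullet> x\<bar> \<le> r ^ k * (norm (w i) * norm x)"
        by (intro mult_mono Cauchy_Schwarz_ineq2) (auto intro: order_trans[OF _ \<open>\<bar>lam i\<bar> ^ k \<le> r ^ k\<close>])
      then show ?thesis using False i by (simp add: norm_eigenvector abs_mult power_abs mult_ac)
    qed
  qed
  also have "\<dots> = (\<Sum>i\<in>I. norm (w i)) * r ^ k * norm x"
    by (simp add: sum_distrib_left mult_ac)
  finally show "norm ((mat_power A (Suc k) - fixed_part) *v x) \<le> (\<Sum>i\<in>I. norm (w i)) * r ^ k * norm x" .
qed

text \<open>
  For \<open>r = 0\<close> the power 0 in the preceding bound would be 1, so the error is guaranteed to vanish
  only from the second power on. The definition of a rate ignores finitely many powers.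
\<close>
lemma convergence_rate_fixed_part:
  assumes "\<And>i. i \<in> I \<Longrightarrow> lam i \<noteq> 1 \<Longrightarrow> \<bar>lam i\<bar> \<le> r" and "0 \<le> r" "r < 1"
  shows "convergence_rate A fixed_part r"
proof -
  define K where "K = (\<Sum>i\<in>I. norm (w i))"
  \<comment> \<open>the factor \<open>1 / r\<close> makes up for the lag of the exponent; the summand 1 makes \<open>M\<close> positive\<close>
  define M where "M = (if r = 0 then 1 else (K + 1) / r)"
  have "0 \<le> K" unfolding K_def by (simp add: sum_nonneg)
  then have "0 < M" using assms(2) by (auto simp: M_def)
  moreover have "op_norm (mat_power A k - fixed_part) \<le> M * r ^ k" if "k > 1" for k
  proof -
    obtain l where l: "k = Suc l" "l > 0" using \<open>k > 1\<close> by (cases k) auto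
    have "K * r ^ l \<le> M * r ^ k"
    proof (cases "r = 0")
      case False
      then have "M * r ^ k = K * r ^ l + r ^ l" unfolding M_def l(1) by (simp add: field_simps)
      then show ?thesis using assms(2) by simp
    qed (use l in \<open>simp add: power_0_left\<close>)
    then show ?thesis
      using op_norm_power_diff_le[OF assms(1,2), of l] unfolding l(1) K_def by linarith
  qed
  ultimately show ?thesis
    unfolding convergence_rate_def using assms(2,3) by (intro conjI exI[of _ M] exI[of _ 1]) auto
qed

text \<open>
  At the eigenvector the error is exactly \<open>\<bar>lam i\<bar>\<^sup>k\<close>, which outgrows \<open>M r\<^sup>k\<close> if \<open>r < \<bar>lam i\<bar>\<close>.
\<close>
lemma abs_eigenvalue_le_rate:
  assumes rate: "convergence_rate A fixed_part r" and i: "i \<in> I" "lam i \<noteq> 1"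
  shows "\<bar>lam i\<bar> \<le> r"
proof (rule ccontr)
  assume "\<not> \<bar>lam i\<bar> \<le> r"
  then have less: "r < \<bar>lam i\<bar>" by simp
  obtain M N where MN: "M > 0" "\<And>k. k > N \<Longrightarrow> op_norm (mat_power A k - fixed_part) \<le> M * r ^ k"
    and "0 \<le> r"
    using rate unfolding convergence_rate_def by auto
  have le: "\<bar>lam i\<bar> ^ k \<le> M * r ^ k" if "k > N" for k
    using eigenvalue_power_le_op_norm[OF i, of k] MN(2)[OF that] by linarith
  show False
  proof (cases "r = 0")
    case True
    then have "0 < \<bar>lam i\<bar> ^ Suc N" using less by (intro zero_less_power) simp
    then show False using le[of "Suc N"] unfolding True by (simp add: power_0_left)
  next
    case False
    then have "0 < r" using \<open>0 \<le> r\<close> by simp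
    then obtain m where m: "M < (\<bar>lam i\<bar> / r) ^ m"
      using real_arch_pow[of "\<bar>lam i\<bar> / r" M] less by auto
    have "(\<bar>lam i\<bar> / r) ^ m \<le> (\<bar>lam i\<bar> / r) ^ (Suc N + m)"
      using less \<open>0 < r\<close> by (intro power_increasing) auto
    also have "\<dots> \<le> M"
      using le[of "Suc N + m"] \<open>0 < r\<close> unfolding power_divide by (simp add: divide_le_eq)
    finally show False using m by simp
  qed
qed

text \<open>
  A complex eigenvector is split into its real and imaginary parts \<open>a\<close> and \<open>b\<close>. The functionals
  \<open>w i\<close> are left eigenvectors, so if one of them does not vanish on \<open>a + \<i> b\<close>, then the eigenvalue is
  \<open>lam i\<close>; if they all vanish, then the matrix annihilates the vector. In particular the spectrum
  is real. Adjoining 0 hides whether the matrix has a kernel.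
\<close>
lemma eigenvalues_eq: "{0} \<union> eigenvalues A = {0} \<union> complex_of_real ` lam ` I"
proof (intro equalityI subsetI)
  fix c assume "c \<in> {0} \<union> complex_of_real ` lam ` I"
  moreover have "complex_of_real (lam i) \<in> eigenvalues A" if i: "i \<in> I" for i
  proof -
    define x :: "complex^'n" where "x = (\<chi> j. complex_of_real (u i $ j))"
    have "x \<noteq> 0"
    proof
      assume "x = 0"
      then have "u i = 0" by (simp add: x_def vec_eq_iff)
      then show False using norm_eigenvector[OF i] by simp
    qed
    moreover have "map_matrix complex_of_real A *v x = complex_of_real (lam i) *s x"
      unfolding vec_eq_iff
    proof
      fix j
      have "(map_matrix complex_of_real A *v x) $ j = complex_of_real ((A *v u i) $ j)"
        by (simp add: matrix_vector_mult_def x_def)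
      then show "(map_matrix complex_of_real A *v x) $ j = (complex_of_real (lam i) *s x) $ j"
        by (simp add: eigenvector[OF i] x_def)
    qed
    ultimately show ?thesis unfolding eigenvalues_def by auto
  qed
  ultimately show "c \<in> {0} \<union> eigenvalues A" by auto
next
  fix c assume "c \<in> {0} \<union> eigenvalues A"
  moreover have "c \<in> complex_of_real ` lam ` I" if c: "c \<in> eigenvalues A" "c \<noteq> 0"
  proof -
    obtain x :: "complex^'n" where "x \<noteq> 0" and x: "map_matrix complex_of_real A *v x = c *s x"
      using c unfolding eigenvalues_def by auto
    define a b where "a = (\<chi> j. Re (x $ j))" and "b = (\<chi> j. Im (x $ j))"
    have coord: "(\<Sum>k\<in>UNIV. complex_of_real (A $ j $ k) * x $ k) = c * x $ j" for j
      using arg_cong[OF x, of "\<lambda>z. z $ j"] by (simp add: matrix_vector_mult_def)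
    have Aa: "A *v a = Re c *\<^sub>R a - Im c *\<^sub>R b"
      using arg_cong[where f = Re, OF coord] by (simp add: vec_eq_iff matrix_vector_mult_def a_def b_def)
    have Ab: "A *v b = Re c *\<^sub>R b + Im c *\<^sub>R a"
      using arg_cong[where f = Im, OF coord] by (simp add: vec_eq_iff matrix_vector_mult_def a_def b_def)
    have left: "w i \<bullet> (A *v y) = lam i * (w i \<bullet> y)" if "i \<in> I" for i y
    proof -
      have "w i \<bullet> (A *v y) = (\<Sum>j\<in>I. if i = j then lam i * (w i \<bullet> y) else 0)"
        unfolding expansion inner_sum_right using that by (intro sum.cong) (auto simp: biorthogonal)
      then show ?thesis using that finite_index by (simp add: sum.delta')
    qed
    have ev: "c = complex_of_real (lam i)" if "i \<in> I" "w i \<bullet> a \<noteq> 0 \<or> w i \<bullet> b \<noteq> 0" for i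
    proof -
      have "c * Complex (w i \<bullet> a) (w i \<bullet> b) = complex_of_real (lam i) * Complex (w i \<bullet> a) (w i \<bullet> b)"
        using left[OF that(1), of a] left[OF that(1), of b]
        by (simp add: complex_eq_iff Aa Ab inner_diff_right inner_add_right)
      moreover have "Complex (w i \<bullet> a) (w i \<bullet> b) \<noteq> 0" using that(2) by (simp add: complex_eq_iff)
      ultimately show ?thesis by simp
    qed
    have "\<exists>i\<in>I. w i \<bullet> a \<noteq> 0 \<or> w i \<bullet> b \<noteq> 0"
    proof (rule ccontr)
      assume "\<not> ?thesis"
      then have "A *v a = 0" "A *v b = 0" unfolding expansion by auto
      then have z: "Re c *\<^sub>R a - Im c *\<^sub>R b = 0" "Re c *\<^sub>R b + Im c *\<^sub>R a = 0"
        using Aa Ab by simp_all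
      have "c * x $ j = 0" for j
        using arg_cong[OF z(1), of "\<lambda>z. z $ j"] arg_cong[OF z(2), of "\<lambda>z. z $ j"]
        by (simp add: complex_eq_iff a_def b_def)
      then show False using \<open>x \<noteq> 0\<close> \<open>c \<noteq> 0\<close> by (simp add: vec_eq_iff)
    qed
    then show ?thesis using ev by blast
  qed
  ultimately show "c \<in> {0} \<union> complex_of_real ` lam ` I" by auto
qed

lemma gamma_mat_eq: "gamma_mat A = Max (insert 0 ((\<lambda>i. \<bar>lam i\<bar>) ` {i\<in>I. lam i \<noteq> 1}))"
proof -
  have "({0} \<union> eigenvalues A) - {1} = insert 0 ((\<lambda>i. complex_of_real (lam i)) ` {i\<in>I. lam i \<noteq> 1})"
    unfolding eigenvalues_eq by auto
  then show ?thesis unfolding gamma_mat_def by (simp add: image_image)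
qed

lemma abs_eigenvalue_le_gamma: "i \<in> I \<Longrightarrow> lam i \<noteq> 1 \<Longrightarrow> \<bar>lam i\<bar> \<le> gamma_mat A"
  unfolding gamma_mat_eq using finite_index by (intro Max_ge) auto

lemma gamma_nonneg: "0 \<le> gamma_mat A"
  unfolding gamma_mat_eq using finite_index by (intro Max_ge) auto

lemma gamma_le_rate: "convergence_rate A fixed_part r \<Longrightarrow> gamma_mat A \<le> r"
  unfolding gamma_mat_eq using finite_index abs_eigenvalue_le_rate
  by (subst Max_le_iff) (auto simp: convergence_rate_def)

lemma gamma_less_one:
  assumes "\<And>i. i \<in> I \<Longrightarrow> -1 < lam i \<and> lam i \<le> 1"
  shows "gamma_mat A < 1"
proof -
  have "\<bar>lam i\<bar> < 1" if "i \<in> I" "lam i \<noteq> 1" for i using assms[OF that(1)] that(2) by auto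
  then show ?thesis unfolding gamma_mat_eq using finite_index by simp
qed

lemma optimal_rate_gamma:
  assumes "\<And>i. i \<in> I \<Longrightarrow> -1 < lam i \<and> lam i \<le> 1"
  shows "optimal_convergence_rate A fixed_part (gamma_mat A)"
proof -
  have rate: "convergence_rate A fixed_part (gamma_mat A)"
    using abs_eigenvalue_le_gamma gamma_nonneg gamma_less_one[OF assms]
    by (intro convergence_rate_fixed_part) auto
  then have "Inf {r. convergence_rate A fixed_part r} = gamma_mat A"
    using gamma_le_rate by (intro cInf_eq_minimum) auto
  then show ?thesis unfolding optimal_convergence_rate_def using rate by simp
qed

lemma convergent_imp_eigenvalue_bounds:
  assumes "convergent_mat A" "i \<in> I"
  shows "-1 < lam i \<and> lam i \<le> 1"
proof -
  obtain L where L: "convergent_mat_to A L" using assms(1) unfolding convergent_mat_def by auto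
  have "(\<lambda>k. (mat_power A k *v u i) \<bullet> u i) \<longlonglongrightarrow> (L *v u i) \<bullet> u i"
    by (intro tendsto_inner tendsto_const convergent_mat_to_vector[OF L])
  then have "convergent (\<lambda>k. lam i ^ k)"
    unfolding convergent_def by (auto simp: mat_power_eigenvector assms orthonormal)
  then show ?thesis by (rule convergent_powers_bounds)
qed

lemma convergent_to_fixed_part:
  assumes "\<And>i. i \<in> I \<Longrightarrow> -1 < lam i \<and> lam i \<le> 1"
  shows "convergent_mat_to A fixed_part"
  using optimal_rate_gamma[OF assms] convergence_rate_imp_convergent
  unfolding optimal_convergence_rate_def by blast

lemma convergent_iff: "convergent_mat A \<longleftrightarrow> (\<forall>i\<in>I. -1 < lam i \<and> lam i \<le> 1)"
proof
  assume "\<forall>i\<in>I. -1 < lam i \<and> lam i \<le> 1"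
  then have "convergent_mat_to A fixed_part" by (intro convergent_to_fixed_part) auto
  then show "convergent_mat A" unfolding convergent_mat_def by auto
qed (intro ballI convergent_imp_eigenvalue_bounds)

text \<open>
  A matrix with a rate towards any limit converges, and limits are unique, so the lower bound for
  rates towards the spectral projection applies to every limit.
\<close>
lemma convergence_rate_ge_gamma:
  assumes "convergence_rate A L r" shows "gamma_mat A \<le> r"
proof -
  have L: "convergent_mat_to A L" using assms by (rule convergence_rate_imp_convergent)
  then have "convergent_mat A" unfolding convergent_mat_def by auto
  then have "convergent_mat_to A fixed_part"
    by (intro convergent_to_fixed_part convergent_imp_eigenvalue_bounds)
  then have "L = fixed_part" using L by (intro convergent_mat_to_unique)
  then show ?thesis using assms gamma_le_rate by simp
qed

end

section \<open>Orthonormal families and orthogonal projections\<close>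

lemma inner_sum_orthonormal:
  fixes u :: "'i \<Rightarrow> 'a::real_inner"
  assumes "finite I" and "\<And>i j. i \<in> I \<Longrightarrow> j \<in> I \<Longrightarrow> u i \<bullet> u j = (if i = j then 1 else 0)" and "j \<in> I"
  shows "(\<Sum>i\<in>I. a i *\<^sub>R u i) \<bullet> u j = a j"
proof -
  have "(\<Sum>i\<in>I. a i *\<^sub>R u i) \<bullet> u j = (\<Sum>i\<in>I. if i = j then a j else 0)"
    unfolding inner_sum_left using assms by (intro sum.cong) auto
  then show ?thesis using assms(1,3) by simp
qed

lemma orthonormal_imp_independent:
  fixes u :: "'i \<Rightarrow> 'a::euclidean_space"
  assumes orth: "\<And>i j. i \<in> I \<Longrightarrow> j \<in> I \<Longrightarrow> u i \<bullet> u j = (if i = j then 1 else 0)"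
  shows "independent (u ` I)" "inj_on u I"
proof -
  show inj: "inj_on u I"
  proof (rule inj_onI, rule ccontr)
    fix i j assume "i \<in> I" "j \<in> I" "u i = u j" "i \<noteq> j"
    then show False using orth[of i i] orth[of i j] by simp
  qed
  show "independent (u ` I)"
  proof (rule pairwise_orthogonal_independent)
    show "pairwise orthogonal (u ` I)"
      by (auto simp: pairwise_def orthogonal_def orth)
    show "0 \<notin> u ` I"
      using orth by force
  qed
qed

lemma orthonormal_expansion:
  fixes u :: "'i \<Rightarrow> 'a::euclidean_space"
  assumes I: "finite I"
    and orth: "\<And>i j. i \<in> I \<Longrightarrow> j \<in> I \<Longrightarrow> u i \<bullet> u j = (if i = j then 1 else 0)"
    and W: "subspace W" "\<And>i. i \<in> I \<Longrightarrow> u i \<in> W" "card I = dim W" and x: "x \<in> W"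
  shows "x = (\<Sum>i\<in>I. (x \<bullet> u i) *\<^sub>R u i)"
proof -
  define y where "y = x - (\<Sum>i\<in>I. (x \<bullet> u i) *\<^sub>R u i)"
  have "y \<in> W"
    unfolding y_def by (intro subspace_diff subspace_sum subspace_scale W x)
  have "card (u ` I) = dim W"
    using orthonormal_imp_independent(2)[of I u, OF orth] W(3) by (simp add: card_image)
  then have "W \<subseteq> span (u ` I)"
    using orthonormal_imp_independent(1)[of I u, OF orth] W(2)
    by (intro card_ge_dim_independent) auto
  moreover have "orthogonal y z" if "z \<in> u ` I" for z
    using that inner_sum_orthonormal[OF I orth] by (auto simp: orthogonal_def y_def inner_diff_left)
  ultimately have "orthogonal y y"
    using \<open>y \<in> W\<close> by (intro orthogonal_to_span[of y "u ` I" y]) auto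
  then have "y = 0" by (simp add: orthogonal_self)
  then show ?thesis by (simp add: y_def)
qed

lemma orthogonal_projection_unique_exists:
  fixes W :: "'a::euclidean_space set"
  assumes "subspace W"
  shows "\<exists>!y. y \<in> W \<and> x - y \<in> W\<^sup>\<bottom>"
proof (rule ex_ex1I)
  have "x \<in> W + W\<^sup>\<bottom>" using subspace_sum_orthogonal_comp[OF assms] by simp
  then obtain y z where "y \<in> W" "z \<in> W\<^sup>\<bottom>" "x = y + z" by (auto elim: set_plus_elim)
  then show "\<exists>y. y \<in> W \<and> x - y \<in> W\<^sup>\<bottom>" by (intro exI[of _ y]) simp
next
  fix y y' assume y: "y \<in> W \<and> x - y \<in> W\<^sup>\<bottom>" "y' \<in> W \<and> x - y' \<in> W\<^sup>\<bottom>"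
  have "(x - y') - (x - y) \<in> W\<^sup>\<bottom>"
    using y subspace_diff[OF subspace_orthogonal_comp, of "x - y'" W "x - y"] by blast
  moreover have "y - y' \<in> W" using y assms by (intro subspace_diff) auto
  ultimately have "orthogonal (y - y') (y - y')" unfolding orthogonal_comp_def by simp
  then show "y = y'" by (simp add: orthogonal_self)
qed

lemma proj_matrix_eqI:
  assumes W: "subspace W" and y: "y \<in> W" "x - y \<in> W\<^sup>\<bottom>"
  shows "proj_matrix W *v x = y"
proof -
  define f where "f = (\<lambda>x. THE y. y \<in> W \<and> x - y \<in> W\<^sup>\<bottom>)"
  have f: "f x \<in> W" "x - f x \<in> W\<^sup>\<bottom>" for x
    using theI'[OF orthogonal_projection_unique_exists[OF W, of x]] by (auto simp: f_def)
  have f_eqI: "f x = y" if "y \<in> W" "x - y \<in> W\<^sup>\<bottom>" for x y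
    using orthogonal_projection_unique_exists[OF W, of x] f[of x] that by blast
  have "linear f"
  proof (rule linearI)
    fix x y c
    have "(x - f x) + (y - f y) \<in> W\<^sup>\<bottom>" by (intro subspace_add subspace_orthogonal_comp f)
    then show "f (x + y) = f x + f y"
      by (intro f_eqI subspace_add W f) (simp add: algebra_simps)
    have "c *\<^sub>R (x - f x) \<in> W\<^sup>\<bottom>" by (intro subspace_scale subspace_orthogonal_comp f)
    then show "f (c *\<^sub>R x) = c *\<^sub>R f x"
      by (intro f_eqI subspace_scale W f) (simp add: algebra_simps)
  qed
  then have "proj_matrix W *v x = f x"
    unfolding proj_matrix_def f_def[symmetric] by (simp add: matrix_works)
  then show ?thesis using f_eqI y by simp
qed

lemma
  assumes W: "subspace W"
  shows proj_matrix_in: "proj_matrix W *v x \<in> W"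
    and proj_matrix_inner: "y \<in> W \<Longrightarrow> y \<bullet> (proj_matrix W *v x) = y \<bullet> x"
proof -
  obtain z where z: "z \<in> W" "x - z \<in> W\<^sup>\<bottom>" using orthogonal_projection_unique_exists[OF W] by blast
  then have eq: "proj_matrix W *v x = z" by (rule proj_matrix_eqI[OF W])
  show "proj_matrix W *v x \<in> W" using z eq by simp
  show "y \<bullet> (proj_matrix W *v x) = y \<bullet> x" if "y \<in> W"
    using z that by (auto simp: eq orthogonal_comp_def orthogonal_def inner_diff_right)
qed

lemma proj_matrix_orthonormal:
  fixes u :: "'i \<Rightarrow> real^'n"
  assumes I: "finite I"
    and orth: "\<And>i j. i \<in> I \<Longrightarrow> j \<in> I \<Longrightarrow> u i \<bullet> u j = (if i = j then 1 else 0)"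
    and W: "subspace W" "\<And>i. i \<in> I \<Longrightarrow> u i \<in> W" "card I = dim W"
  shows "proj_matrix W *v x = (\<Sum>i\<in>I. (u i \<bullet> x) *\<^sub>R u i)"
proof -
  have "proj_matrix W *v x = (\<Sum>i\<in>I. ((proj_matrix W *v x) \<bullet> u i) *\<^sub>R u i)"
    by (intro orthonormal_expansion[OF I orth W] proj_matrix_in W)
  also have "\<dots> = (\<Sum>i\<in>I. (u i \<bullet> x) *\<^sub>R u i)"
    using proj_matrix_inner[OF W(1) W(2)] by (intro sum.cong) (auto simp: inner_commute)
  finally show ?thesis .
qed

section \<open>Principal vectors are singular vectors\<close>

text \<open>
  First-order condition for maximizing the functional \<open>a\<close> on the unit sphere of \<open>W\<close>: the
  projection of \<open>a\<close> onto \<open>W\<close> is a multiple of the maximizer \<open>v\<close>. It is obtained by moving from \<open>v\<close> along a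
  vector \<open>z\<close> of \<open>W\<close> orthogonal to \<open>v\<close>, where the norm grows only quadratically.
\<close>
lemma maximizer_inner:
  fixes a :: "'a::real_inner"
  assumes W: "subspace W" and v: "v \<in> W" "norm v = 1"
    and max: "\<And>y. y \<in> W \<Longrightarrow> norm y = 1 \<Longrightarrow> a \<bullet> y \<le> a \<bullet> v" and y: "y \<in> W"
  shows "a \<bullet> y = (a \<bullet> v) * (v \<bullet> y)"
proof -
  define z where "z = y - (v \<bullet> y) *\<^sub>R v"
  have vv: "v \<bullet> v = 1" using v(2) by (simp add: norm_eq_1)
  have z: "z \<in> W" "v \<bullet> z = 0"
    unfolding z_def using W v y by (auto intro!: subspace_diff subspace_scale simp: inner_diff_right vv)
  have "0 \<le> a \<bullet> v"
    using max[of "- v"] v W by (simp add: subspace_neg)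
  have le: "t * (a \<bullet> z) \<le> (a \<bullet> v) * (z \<bullet> z) * t\<^sup>2" for t
  proof -
    define n where "n = norm (v + t *\<^sub>R z)"
    have n2: "n\<^sup>2 = 1 + t\<^sup>2 * (z \<bullet> z)"
      unfolding n_def power2_norm_eq_inner using z(2)
      by (simp add: inner_add_left inner_add_right vv inner_commute[of z v] power2_eq_square)
    then have "1 \<le> n\<^sup>2" by simp
    then have "1 \<le> n" by (simp add: n_def power2_nonneg_ge_1_iff)
    have "a \<bullet> ((1/n) *\<^sub>R (v + t *\<^sub>R z)) \<le> a \<bullet> v"
      using \<open>1 \<le> n\<close> by (intro max subspace_scale subspace_add W v z) (auto simp: n_def)
    then have "(a \<bullet> v) + t * (a \<bullet> z) \<le> (a \<bullet> v) * n"
      using \<open>1 \<le> n\<close> by (simp add: inner_add_right field_simps)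
    also have "\<dots> \<le> (a \<bullet> v) * n\<^sup>2"
      using \<open>1 \<le> n\<close> \<open>0 \<le> a \<bullet> v\<close> by (intro mult_left_mono) (simp_all add: power2_eq_square)
    finally show ?thesis by (simp add: n2 algebra_simps)
  qed
  define D where "D = (a \<bullet> v) * (z \<bullet> z)"
  have "0 \<le> D" unfolding D_def using \<open>0 \<le> a \<bullet> v\<close> by simp
  \<comment> \<open>a linear term is dominated by \<open>D t\<^sup>2\<close> for all \<open>t\<close>; this value of \<open>t\<close> shows that it vanishes\<close>
  have "(a \<bullet> z) / (D + 1) * (a \<bullet> z) \<le> D * ((a \<bullet> z) / (D + 1))\<^sup>2"
    unfolding D_def by (rule le)
  then have "(a \<bullet> z)\<^sup>2 * (D + 1) \<le> (a \<bullet> z)\<^sup>2 * D"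
    using \<open>0 \<le> D\<close> by (simp add: divide_simps power2_eq_square mult_ac split: if_splits)
  then have "a \<bullet> z = 0" by (simp add: algebra_simps)
  then show ?thesis by (simp add: z_def inner_diff_right mult.commute)
qed

lemma downward_closed_eq_atLeastAtMost:
  fixes J :: "nat set"
  assumes "J \<subseteq> {1..m}" "\<And>k l. l \<in> J \<Longrightarrow> k \<in> {1..l} \<Longrightarrow> k \<in> J"
  shows "J = {1..card J}"
proof -
  have fin: "finite J" using assms(1) finite_subset by blast
  have "\<exists>M. J = {1..M}"
  proof (cases "J = {}")
    case False
    have "J = {1..Max J}"
    proof (intro equalityI subsetI)
      fix k assume "k \<in> J" then show "k \<in> {1..Max J}" using assms(1) Max_ge[OF fin, of k] by auto
    qed (use assms(2) Max_in[OF fin False] in blast)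
    then show ?thesis by blast
  qed (auto intro: exI[of _ 0])
  then obtain M where "J = {1..M}" by blast
  then show ?thesis by simp
qed

text \<open>
  The first \<open>m\<close> steps of the recursion for the principal angles. The cosines \<open>u k \<bullet> v k\<close> stand for
  the angles, and the roles of the two subspaces can be exchanged.
\<close>
locale principal_vectors =
  fixes U V :: "'a::euclidean_space set" and u v :: "nat \<Rightarrow> 'a" and m :: nat
  assumes subspace_U: "subspace U" and subspace_V: "subspace V"
    and admissible: "k \<in> {1..m} \<Longrightarrow> (u k, v k) \<in> principal_pairs U V u v k"
    and maximal: "k \<in> {1..m} \<Longrightarrow> (x, y) \<in> principal_pairs U V u v k \<Longrightarrow> x \<bullet> y \<le> u k \<bullet> v k"
begin

lemma in_U: "k \<in> {1..m} \<Longrightarrow> u k \<in> U" and norm_u: "k \<in> {1..m} \<Longrightarrow> norm (u k) = 1"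
  using admissible[of k] by (auto simp: principal_pairs_def)

lemma swap: "principal_vectors V U v u m"
proof
  fix k x y assume k: "k \<in> {1..m}"
  have eq: "(b, a) \<in> principal_pairs V U v u k \<longleftrightarrow> (a, b) \<in> principal_pairs U V u v k" for a b
    unfolding principal_pairs_def by auto
  show "(v k, u k) \<in> principal_pairs V U v u k" using admissible[OF k] by (simp add: eq)
  show "x \<bullet> y \<le> v k \<bullet> u k" if "(x, y) \<in> principal_pairs V U v u k"
    using maximal[OF k, of y x] that by (simp add: eq inner_commute)
qed (rule subspace_V subspace_U)+

lemma orthonormal_u:
  assumes "i \<in> {1..m}" "j \<in> {1..m}"
  shows "u i \<bullet> u j = (if i = j then 1 else 0)"
proof -
  have "u i \<bullet> u j = 0" if "i \<in> {1..m}" "j \<in> {1..<i}" for i j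
    using admissible[OF that(1)] that(2) by (auto simp: principal_pairs_def)
  moreover have "u i \<bullet> u i = 1" using norm_u[OF assms(1)] by (simp add: norm_eq_1)
  ultimately show ?thesis
    using assms inner_commute[of "u i" "u j"] by (cases i j rule: linorder_cases) auto
qed

text \<open>
  The maximality of \<open>v k\<close> only concerns vectors orthogonal to the earlier \<open>v j\<close>. Subtracting the
  components along these reduces a general vector of \<open>V\<close> to that case, as \<open>u k\<close> is orthogonal to
  them.
\<close>
lemma first_order_condition:
  assumes k: "k \<in> {1..m}" and orth: "\<And>j. j \<in> {1..<k} \<Longrightarrow> u k \<bullet> v j = 0" and y: "y \<in> V"
  shows "u k \<bullet> y = (u k \<bullet> v k) * (v k \<bullet> y)"
proof -
  interpret swap: principal_vectors V U v u m by (rule swap)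
  define W where "W = {y\<in>V. \<forall>j\<in>{1..<k}. y \<bullet> v j = 0}"
  define z where "z = y - (\<Sum>j\<in>{1..<k}. (y \<bullet> v j) *\<^sub>R v j)"
  have "subspace W"
    using subspace_V unfolding W_def subspace_def by (auto simp: inner_add_left)
  have "z \<in> V"
    unfolding z_def using k by (intro subspace_diff subspace_sum subspace_scale subspace_V y swap.in_U) auto
  moreover have "z \<bullet> v j = 0" if "j \<in> {1..<k}" for j
    using that k inner_sum_orthonormal[of "{1..<k}" v j] by (simp add: z_def inner_diff_left swap.orthonormal_u)
  ultimately have "z \<in> W" unfolding W_def by simp
  have "u k \<bullet> z = (u k \<bullet> v k) * (v k \<bullet> z)"
  proof (rule maximizer_inner[OF \<open>subspace W\<close> _ _ _ \<open>z \<in> W\<close>])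
    show "v k \<in> W" "norm (v k) = 1" using admissible[OF k] by (auto simp: W_def principal_pairs_def)
    show "u k \<bullet> x \<le> u k \<bullet> v k" if "x \<in> W" "norm x = 1" for x
      using that admissible[OF k] by (intro maximal k) (auto simp: W_def principal_pairs_def)
  qed
  moreover have "u k \<bullet> z = u k \<bullet> y" by (simp add: z_def inner_diff_right inner_sum_right orth)
  moreover have "v k \<bullet> v j = 0" if "j \<in> {1..<k}" for j using that k by (simp add: swap.orthonormal_u)
  then have "v k \<bullet> z = v k \<bullet> y" by (simp add: z_def inner_diff_right inner_sum_right)
  ultimately show ?thesis by simp
qed

text \<open>
  In terms of projections, \<open>P\<^sub>V (u k) = c v k\<close> and \<open>P\<^sub>U (v k) = c u k\<close> with \<open>c = u k \<bullet> v k\<close>. Both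
  statements are proved by one induction, since each of them at smaller indices provides the
  orthogonality relations that the other needs at \<open>k\<close>.
\<close>
lemma singular_vectors:
  assumes "k \<in> {1..m}"
  shows "(\<forall>y\<in>V. u k \<bullet> y = (u k \<bullet> v k) * (v k \<bullet> y)) \<and> (\<forall>x\<in>U. v k \<bullet> x = (u k \<bullet> v k) * (u k \<bullet> x))"
  using assms
proof (induction k rule: less_induct)
  case (less k)
  interpret swap: principal_vectors V U v u m by (rule swap)
  note k = less.prems
  have "u k \<bullet> v j = 0" "v k \<bullet> u j = 0" if j: "j \<in> {1..<k}" for j
  proof -
    have j': "j \<in> {1..m}" "j < k" using j k by auto
    have "v j \<bullet> u k = (u j \<bullet> v j) * (u j \<bullet> u k)" "u j \<bullet> v k = (u j \<bullet> v j) * (v j \<bullet> v k)"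
      using less.IH[OF j'(2,1)] in_U[OF k] swap.in_U[OF k] by auto
    then show "u k \<bullet> v j = 0" "v k \<bullet> u j = 0"
      using j' k by (simp_all add: orthonormal_u swap.orthonormal_u inner_commute)
  qed
  then show ?case
    using first_order_condition[OF k] swap.first_order_condition[OF k] by (auto simp: inner_commute[of "v k" "u k"])
qed

lemma inner_principal_u: "k \<in> {1..m} \<Longrightarrow> y \<in> V \<Longrightarrow> u k \<bullet> y = (u k \<bullet> v k) * (v k \<bullet> y)"
  and inner_principal_v: "k \<in> {1..m} \<Longrightarrow> x \<in> U \<Longrightarrow> v k \<bullet> x = (u k \<bullet> v k) * (u k \<bullet> x)"
  using singular_vectors by blast+

lemma cosine_antimono:
  assumes "k \<in> {1..m}" "l \<in> {1..m}" "k \<le> l"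
  shows "u l \<bullet> v l \<le> u k \<bullet> v k"
  using admissible[OF assms(2)] assms(3) by (intro maximal assms(1)) (auto simp: principal_pairs_def)

lemma cosine_nonneg:
  assumes "k \<in> {1..m}" shows "0 \<le> u k \<bullet> v k"
proof -
  have "(- u k, v k) \<in> principal_pairs U V u v k"
    using admissible[OF assms] subspace_neg[OF subspace_U] by (auto simp: principal_pairs_def)
  from maximal[OF assms this] show ?thesis by simp
qed

lemma cosine_le_1:
  assumes "k \<in> {1..m}" shows "u k \<bullet> v k \<le> 1"
  using norm_cauchy_schwarz[of "u k" "v k"] admissible[OF assms] by (auto simp: principal_pairs_def)

lemma cosine_eq_1_imp_eq:
  assumes "k \<in> {1..m}" "u k \<bullet> v k = 1" shows "u k = v k"
proof -
  have "(u k - v k) \<bullet> (u k - v k) = 0"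
    using admissible[OF assms(1)] assms(2)
    by (auto simp: principal_pairs_def norm_eq_1 inner_diff_left inner_diff_right inner_commute)
  then show ?thesis by simp
qed

text \<open>
  The vectors \<open>u k\<close> with cosine 1 coincide with \<open>v k\<close>, so they lie in the intersection. They span it:
  for a common vector \<open>x\<close>, the two singular vector relations give
  \<open>u k \<bullet> x = (u k \<bullet> v k)\<^sup>2 (u k \<bullet> x)\<close>, which kills the components with a smaller cosine. So their
  number is the dimension of the intersection, and they come first because the cosines decrease.
\<close>
lemma cosine_eq_1_indices:
  assumes "m = dim U"
  shows "{k\<in>{1..m}. u k \<bullet> v k = 1} = {1..dim (U \<inter> V)}"
proof -
  define J where "J = {k\<in>{1..m}. u k \<bullet> v k = 1}"
  have orth: "u i \<bullet> u j = (if i = j then 1 else 0)" if "i \<in> J" "j \<in> J" for i j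
    using that by (intro orthonormal_u) (auto simp: J_def)
  have fin: "finite J" by (simp add: J_def)
  have "u ` J \<subseteq> U \<inter> V"
  proof (rule image_subsetI)
    fix k assume "k \<in> J"
    then have k: "k \<in> {1..m}" "u k = v k" by (auto simp: J_def intro: cosine_eq_1_imp_eq)
    then show "u k \<in> U \<inter> V" using in_U[OF k(1)] principal_vectors.in_U[OF swap k(1)] by simp
  qed
  moreover have "U \<inter> V \<subseteq> span (u ` J)"
  proof
    fix x assume x: "x \<in> U \<inter> V"
    have "u k \<bullet> x = 0" if k: "k \<in> {1..m}" "k \<notin> J" for k
    proof -
      have c: "0 \<le> u k \<bullet> v k" "u k \<bullet> v k < 1"
        using cosine_nonneg cosine_le_1[of k] k by (auto simp: J_def)
      have "u k \<bullet> x = (u k \<bullet> v k) * (v k \<bullet> x)" "v k \<bullet> x = (u k \<bullet> v k) * (u k \<bullet> x)"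
        using inner_principal_u[OF k(1)] inner_principal_v[OF k(1)] x by blast+
      then have "(1 - (u k \<bullet> v k)\<^sup>2) * (u k \<bullet> x) = 0" by (simp add: power2_eq_square algebra_simps)
      moreover have "(u k \<bullet> v k)\<^sup>2 < 1" using c by (simp add: power_less_one_iff abs_square_less_1)
      ultimately show ?thesis by simp
    qed
    then have "(x \<bullet> u k) *\<^sub>R u k \<in> span (u ` J)" if "k \<in> {1..m}" for k
      using that by (cases "k \<in> J") (auto simp: inner_commute intro: span_base span_scale span_zero)
    then have "(\<Sum>k\<in>{1..m}. (x \<bullet> u k) *\<^sub>R u k) \<in> span (u ` J)" by (intro span_sum)
    moreover have "x = (\<Sum>k\<in>{1..m}. (x \<bullet> u k) *\<^sub>R u k)"
      using assms x by (intro orthonormal_expansion[of _ u U]) (auto simp: subspace_U in_U orthonormal_u)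
    ultimately show "x \<in> span (u ` J)" by simp
  qed
  ultimately have "card (u ` J) = dim (U \<inter> V)"
    using orthonormal_imp_independent(1)[of J u, OF orth] by (intro basis_card_eq_dim) auto
  then have "card J = dim (U \<inter> V)"
    using orthonormal_imp_independent(2)[of J u, OF orth] by (simp add: card_image)
  moreover have "J = {1..card J}"
  proof (rule downward_closed_eq_atLeastAtMost)
    show "J \<subseteq> {1..m}" by (auto simp: J_def)
    fix k l assume l: "l \<in> J" "k \<in> {1..l}"
    then have "u l \<bullet> v l \<le> u k \<bullet> v k" by (intro cosine_antimono) (auto simp: J_def)
    then show "k \<in> J" using l cosine_le_1[of k] by (auto simp: J_def)
  qed
  ultimately show ?thesis by (simp add: J_def)
qed

lemma common_principal_vector:
  assumes "m = dim U" "k \<in> {1..dim (U \<inter> V)}"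
  shows "k \<in> {1..m}" "u k = v k" "u k \<in> U \<inter> V"
proof -
  have "k \<in> {k\<in>{1..m}. u k \<bullet> v k = 1}" unfolding cosine_eq_1_indices[OF assms(1)] by (rule assms(2))
  then have k: "k \<in> {1..m}" "u k \<bullet> v k = 1" by auto
  then show "k \<in> {1..m}" "u k = v k" by (auto intro: cosine_eq_1_imp_eq)
  then show "u k \<in> U \<inter> V" using in_U[OF k(1)] principal_vectors.in_U[OF swap k(1)] by simp
qed

lemma intersection_expansion:
  assumes "m = dim U" "x \<in> U \<inter> V"
  shows "x = (\<Sum>k\<in>{1..dim (U \<inter> V)}. (x \<bullet> u k) *\<^sub>R u k)"
proof (rule orthonormal_expansion[of _ u "U \<inter> V"])
  fix i j assume "i \<in> {1..dim (U \<inter> V)}" "j \<in> {1..dim (U \<inter> V)}"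
  then show "u i \<bullet> u j = (if i = j then 1 else 0)"
    by (intro orthonormal_u common_principal_vector(1)[OF assms(1)])
qed (use assms(2) in \<open>simp_all add: subspace_inter subspace_U subspace_V common_principal_vector(3)[OF assms(1), simplified]\<close>)

text \<open>
  The first principal vectors form an orthonormal basis of the intersection. Therefore the pairs
  admissible in the next step are the pairs of unit vectors orthogonal to the intersection, over
  which the Friedrichs cosine is the maximum.
\<close>
lemma friedrichs_cos_eq:
  assumes "m = dim U" "dim (U \<inter> V) < m"
  shows "friedrichs_cos U V = u (Suc (dim (U \<inter> V))) \<bullet> v (Suc (dim (U \<inter> V)))"
proof -
  define s where "s = dim (U \<inter> V)"
  have k: "Suc s \<in> {1..m}" using assms by (simp add: s_def)
  have comp: "x \<in> (U \<inter> V)\<^sup>\<bottom> \<longleftrightarrow> (\<forall>j\<in>{1..<Suc s}. x \<bullet> u j = 0)" for x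
  proof
    assume "x \<in> (U \<inter> V)\<^sup>\<bottom>"
    then show "\<forall>j\<in>{1..<Suc s}. x \<bullet> u j = 0"
      using common_principal_vector(3)[OF assms(1)]
      by (auto simp: orthogonal_comp_def orthogonal_def s_def inner_commute)
  next
    assume x: "\<forall>j\<in>{1..<Suc s}. x \<bullet> u j = 0"
    have "y \<bullet> x = 0" if "y \<in> U \<inter> V" for y
    proof -
      have "y \<bullet> x = (\<Sum>k\<in>{1..s}. (y \<bullet> u k) * (u k \<bullet> x))"
        unfolding s_def by (subst intersection_expansion[OF assms(1) that]) (simp add: inner_sum_left)
      also have "\<dots> = 0" using x by (intro sum.neutral) (auto simp: inner_commute)
      finally show ?thesis .
    qed
    then show "x \<in> (U \<inter> V)\<^sup>\<bottom>" by (auto simp: orthogonal_comp_def orthogonal_def)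
  qed
  have eq: "\<forall>j\<in>{1..<Suc s}. v j = u j" using common_principal_vector(2)[OF assms(1)] by (simp add: s_def)
  have pairs: "(x, y) \<in> principal_pairs U V u v (Suc s) \<longleftrightarrow>
      x \<in> U \<inter> (U \<inter> V)\<^sup>\<bottom> \<and> y \<in> V \<inter> (U \<inter> V)\<^sup>\<bottom> \<and> norm x = 1 \<and> norm y = 1" for x y
    unfolding principal_pairs_def Int_iff comp using eq by auto
  show ?thesis
    unfolding friedrichs_cos_def s_def[symmetric]
  proof (rule Greatest_equality)
    show "\<exists>x y. x \<in> U \<inter> (U \<inter> V)\<^sup>\<bottom> \<and> y \<in> V \<inter> (U \<inter> V)\<^sup>\<bottom> \<and> norm x = 1 \<and> norm y = 1 \<and>
        u (Suc s) \<bullet> v (Suc s) = x \<bullet> y"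
      using admissible[OF k] unfolding pairs by blast
  next
    fix c assume "\<exists>x y. x \<in> U \<inter> (U \<inter> V)\<^sup>\<bottom> \<and> y \<in> V \<inter> (U \<inter> V)\<^sup>\<bottom> \<and> norm x = 1 \<and> norm y = 1 \<and> c = x \<bullet> y"
    then obtain x y where "(x, y) \<in> principal_pairs U V u v (Suc s)" "c = x \<bullet> y" unfolding pairs by blast
    then show "c \<le> u (Suc s) \<bullet> v (Suc s)" using maximal[OF k] by simp
  qed
qed

end

section \<open>Diagonal form of the relaxed projection\<close>

lemma relaxed_proj_eq:
  "relaxed_proj U V \<mu> = (1 - \<mu>) *\<^sub>R proj_matrix U + \<mu> *\<^sub>R (proj_matrix U ** proj_matrix V)"
  unfolding relaxed_proj_def
  by (simp add: matrix_eq matrix_vector_mul_assoc[symmetric] matrix_vector_mult_add_rdistrib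
      matrix_vector_right_distrib scaleR_matrix_vector_assoc[symmetric] matrix_vector_mult_scaleR)

locale relaxed_projection =
  principal_vectors U V u v "dim U" for U V :: "(real^'n) set" and u v :: "nat \<Rightarrow> real^'n" +
  fixes \<mu> :: real
begin

definition sin_sq :: "nat \<Rightarrow> real" where
  "sin_sq i = 1 - (u i \<bullet> v i)\<^sup>2"

text \<open>
  The coordinate of \<open>S x\<close> along \<open>u i\<close> is \<open>u i \<bullet> ((1 - \<mu>) x + \<mu> P\<^sub>V x)\<close>. The projection moves to the
  other side as \<open>P\<^sub>V (u i) = (u i \<bullet> v i) v i\<close>, which produces the functional. Its biorthogonality to
  the \<open>u j\<close> is the dual relation \<open>P\<^sub>U (v i) = (u i \<bullet> v i) u i\<close>.
\<close>
sublocale diagonal_expansion "relaxed_proj U V \<mu>" "{1..dim U}" u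
  "\<lambda>i. (1 - \<mu>) *\<^sub>R u i + (\<mu> * (u i \<bullet> v i)) *\<^sub>R v i" "\<lambda>i. 1 - \<mu> * sin_sq i"
proof
  fix x
  define z where "z = (1 - \<mu>) *\<^sub>R x + \<mu> *\<^sub>R (proj_matrix V *v x)"
  have "relaxed_proj U V \<mu> *v x = proj_matrix U *v z"
    unfolding relaxed_proj_def z_def
    by (simp add: matrix_vector_mul_assoc[symmetric] matrix_vector_mult_add_rdistrib scaleR_matrix_vector_assoc[symmetric])
  also have "\<dots> = (\<Sum>i\<in>{1..dim U}. (u i \<bullet> z) *\<^sub>R u i)"
    by (rule proj_matrix_orthonormal) (auto simp: orthonormal_u in_U subspace_U)
  also have "\<dots> = (\<Sum>i\<in>{1..dim U}. (((1 - \<mu>) *\<^sub>R u i + (\<mu> * (u i \<bullet> v i)) *\<^sub>R v i) \<bullet> x) *\<^sub>R u i)"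
  proof (rule sum.cong[OF refl])
    fix i assume i: "i \<in> {1..dim U}"
    have "u i \<bullet> (proj_matrix V *v x) = (u i \<bullet> v i) * (v i \<bullet> x)"
      using inner_principal_u[OF i proj_matrix_in[OF subspace_V]]
        proj_matrix_inner[OF subspace_V principal_vectors.in_U[OF swap i]] by simp
    then show "(u i \<bullet> z) *\<^sub>R u i = (((1 - \<mu>) *\<^sub>R u i + (\<mu> * (u i \<bullet> v i)) *\<^sub>R v i) \<bullet> x) *\<^sub>R u i"
      by (simp add: z_def inner_add_left inner_add_right)
  qed
  finally show "relaxed_proj U V \<mu> *v x
      = (\<Sum>i\<in>{1..dim U}. (((1 - \<mu>) *\<^sub>R u i + (\<mu> * (u i \<bullet> v i)) *\<^sub>R v i) \<bullet> x) *\<^sub>R u i)" .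
next
  fix i j assume ij: "i \<in> {1..dim U}" "j \<in> {1..dim U}"
  then show "u i \<bullet> u j = (if i = j then 1 else 0)" by (rule orthonormal_u)
  have "v i \<bullet> u j = (u i \<bullet> v i) * (u i \<bullet> u j)"
    by (rule inner_principal_v[OF ij(1) in_U[OF ij(2)]])
  then show "((1 - \<mu>) *\<^sub>R u i + (\<mu> * (u i \<bullet> v i)) *\<^sub>R v i) \<bullet> u j
      = (if i = j then 1 - \<mu> * sin_sq i else 0)"
    by (simp add: inner_add_left orthonormal_u[OF ij] sin_sq_def power2_eq_square algebra_simps)
qed simp

lemma sin_sq_mono:
  assumes "i \<in> {1..dim U}" "j \<in> {1..dim U}" "i \<le> j"
  shows "sin_sq i \<le> sin_sq j"
  unfolding sin_sq_def using cosine_antimono[OF assms] cosine_nonneg[OF assms(2)]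
  by (simp add: power_mono)

lemma sin_sq_nonneg: "i \<in> {1..dim U} \<Longrightarrow> 0 \<le> sin_sq i"
  unfolding sin_sq_def using cosine_nonneg[of i] cosine_le_1[of i] by (simp add: power_le_one)

lemma sin_sq_eq_0_iff:
  assumes "i \<in> {1..dim U}"
  shows "sin_sq i = 0 \<longleftrightarrow> i \<le> dim (U \<inter> V)"
proof -
  have "sin_sq i = 0 \<longleftrightarrow> u i \<bullet> v i = 1"
    using cosine_nonneg[OF assms] by (auto simp: sin_sq_def power2_eq_1_iff)
  also have "\<dots> \<longleftrightarrow> i \<in> {k\<in>{1..dim U}. u k \<bullet> v k = 1}" using assms by simp
  also have "\<dots> \<longleftrightarrow> i \<le> dim (U \<inter> V)" unfolding cosine_eq_1_indices[OF refl] using assms by simp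
  finally show ?thesis .
qed

text \<open>
  On the indices of the intersection \<open>v i = u i\<close>, so the functional
  \<open>(1 - \<mu>) u i + \<mu> v i\<close> is \<open>u i\<close> itself, and the spectral projection is orthogonal.
\<close>
lemma fixed_part_eq_proj:
  assumes "\<mu> \<noteq> 0"
  shows "fixed_part = proj_matrix (U \<inter> V)"
proof (rule matrix_eq[THEN iffD2], rule allI)
  fix x
  have "dim (U \<inter> V) \<le> dim U" by (intro dim_subset) auto
  then have "{i\<in>{1..dim U}. 1 - \<mu> * sin_sq i = 1} = {1..dim (U \<inter> V)}"
    using assms by (auto simp: sin_sq_eq_0_iff)
  then have "fixed_part *v x
      = (\<Sum>i\<in>{1..dim (U \<inter> V)}. (((1 - \<mu>) *\<^sub>R u i + (\<mu> * (u i \<bullet> v i)) *\<^sub>R v i) \<bullet> x) *\<^sub>R u i)"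
    by (simp only: fixed_part_apply)
  also have "\<dots> = (\<Sum>i\<in>{1..dim (U \<inter> V)}. (u i \<bullet> x) *\<^sub>R u i)"
  proof (rule sum.cong[OF refl])
    fix i assume "i \<in> {1..dim (U \<inter> V)}"
    then have i: "i \<in> {1..dim U}" "v i = u i" using common_principal_vector[OF refl] by simp_all
    then show "(((1 - \<mu>) *\<^sub>R u i + (\<mu> * (u i \<bullet> v i)) *\<^sub>R v i) \<bullet> x) *\<^sub>R u i = (u i \<bullet> x) *\<^sub>R u i"
      by (simp add: orthonormal_u scaleR_left_distrib[symmetric])
  qed
  also have "\<dots> = proj_matrix (U \<inter> V) *v x"
  proof (rule proj_matrix_orthonormal[symmetric])
    fix i j assume "i \<in> {1..dim (U \<inter> V)}" "j \<in> {1..dim (U \<inter> V)}"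
    then show "u i \<bullet> u j = (if i = j then 1 else 0)"
      by (intro orthonormal_u common_principal_vector(1)[OF refl])
  qed (use common_principal_vector(3)[OF refl] subspace_inter[OF subspace_U subspace_V] in simp_all)
  finally show "fixed_part *v x = proj_matrix (U \<inter> V) *v x" .
qed

text \<open>
  The largest squared sine decides. If \<open>U \<subseteq> V\<close>, then all sines vanish and the powers converge for
  negative \<open>\<mu>\<close> as well, which the second assumption rules out.
\<close>
lemma convergent_relaxed_iff:
  assumes "dim U \<ge> 1" and "dim (U \<inter> V) < dim U \<or> 0 \<le> \<mu>"
  shows "convergent_mat (relaxed_proj U V \<mu>) \<longleftrightarrow> 0 \<le> \<mu> \<and> \<mu> * sin_sq (dim U) < 2"
proof -
  have p: "dim U \<in> {1..dim U}" using assms(1) by simp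
  have "convergent_mat (relaxed_proj U V \<mu>) \<longleftrightarrow> (\<forall>i\<in>{1..dim U}. 0 \<le> \<mu> * sin_sq i \<and> \<mu> * sin_sq i < 2)"
    unfolding convergent_iff by (intro ball_cong refl) linarith
  also have "\<dots> \<longleftrightarrow> 0 \<le> \<mu> \<and> \<mu> * sin_sq (dim U) < 2"
  proof
    assume "\<forall>i\<in>{1..dim U}. 0 \<le> \<mu> * sin_sq i \<and> \<mu> * sin_sq i < 2"
    then have "0 \<le> \<mu> * sin_sq (dim U)" "\<mu> * sin_sq (dim U) < 2" using p by blast+
    moreover have "0 < sin_sq (dim U)" if "dim (U \<inter> V) < dim U"
      using sin_sq_nonneg[OF p] sin_sq_eq_0_iff[OF p] that by linarith
    ultimately show "0 \<le> \<mu> \<and> \<mu> * sin_sq (dim U) < 2" using assms(2) by (auto simp: zero_le_mult_iff)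
  next
    assume mu: "0 \<le> \<mu> \<and> \<mu> * sin_sq (dim U) < 2"
    show "\<forall>i\<in>{1..dim U}. 0 \<le> \<mu> * sin_sq i \<and> \<mu> * sin_sq i < 2"
    proof
      fix i assume i: "i \<in> {1..dim U}"
      then have "\<mu> * sin_sq i \<le> \<mu> * sin_sq (dim U)" using mu by (intro mult_left_mono sin_sq_mono p) auto
      then show "0 \<le> \<mu> * sin_sq i \<and> \<mu> * sin_sq i < 2" using mu sin_sq_nonneg[OF i] by auto
    qed
  qed
  finally show ?thesis .
qed

text \<open>
  The eigenvalues other than 0 and 1 lie in the interval whose end points are the ones for the
  smallest positive and the largest squared sine, and \<open>\<bar>\<cdot>\<bar>\<close> is largest at an end point.
\<close>
lemma gamma_relaxed:
  assumes "0 < \<mu>" and less: "dim (U \<inter> V) < dim U"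
  shows "gamma_mat (relaxed_proj U V \<mu>)
    = max (1 - \<mu> * sin_sq (Suc (dim (U \<inter> V)))) (\<mu> * sin_sq (dim U) - 1)"
proof (rule antisym)
  define s where "s = dim (U \<inter> V)"
  have range: "Suc s \<in> {1..dim U}" "dim U \<in> {1..dim U}" using less by (auto simp: s_def)
  let ?g = "max (1 - \<mu> * sin_sq (Suc s)) (\<mu> * sin_sq (dim U) - 1)"
  have bound: "\<bar>1 - \<mu> * sin_sq i\<bar> \<le> ?g" if i: "i \<in> {Suc s..dim U}" for i
  proof -
    have "\<mu> * sin_sq (Suc s) \<le> \<mu> * sin_sq i" "\<mu> * sin_sq i \<le> \<mu> * sin_sq (dim U)"
      using assms(1) i by (auto intro!: mult_left_mono sin_sq_mono)
    then show ?thesis by linarith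
  qed
  have "i \<in> {Suc s..dim U}" if "i \<in> {1..dim U}" "1 - \<mu> * sin_sq i \<noteq> 1" for i
    using that sin_sq_eq_0_iff[OF that(1)] by (auto simp: s_def not_less_eq_eq)
  moreover have "0 \<le> ?g" using bound[of "Suc s"] range by force
  ultimately show "gamma_mat (relaxed_proj U V \<mu>)
      \<le> max (1 - \<mu> * sin_sq (Suc (dim (U \<inter> V)))) (\<mu> * sin_sq (dim U) - 1)"
    unfolding gamma_mat_eq s_def[symmetric] using bound by (subst Max_le_iff) auto
  have "\<bar>1 - \<mu> * sin_sq i\<bar> \<le> gamma_mat (relaxed_proj U V \<mu>)" if "i \<in> {Suc s..dim U}" for i
    using that assms(1) sin_sq_eq_0_iff[of i] by (intro abs_eigenvalue_le_gamma) (auto simp: s_def)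
  from this[of "Suc s"] this[of "dim U"]
  show "max (1 - \<mu> * sin_sq (Suc (dim (U \<inter> V)))) (\<mu> * sin_sq (dim U) - 1) \<le> gamma_mat (relaxed_proj U V \<mu>)"
    using range less unfolding s_def[symmetric] by auto
qed

lemma relaxed_optimal_rate:
  assumes "0 < \<mu>" "\<mu> * sin_sq (dim U) < 2" "dim (U \<inter> V) < dim U"
  shows "convergent_mat_to (relaxed_proj U V \<mu>) (proj_matrix (U \<inter> V))"
    and "optimal_convergence_rate (relaxed_proj U V \<mu>) (proj_matrix (U \<inter> V)) (gamma_mat (relaxed_proj U V \<mu>))"
proof -
  have "convergent_mat (relaxed_proj U V \<mu>)" using assms by (subst convergent_relaxed_iff) auto
  then have bounds: "- 1 < 1 - \<mu> * sin_sq i \<and> 1 - \<mu> * sin_sq i \<le> 1" if "i \<in> {1..dim U}" for i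
    using convergent_imp_eigenvalue_bounds that by blast
  have P: "proj_matrix (U \<inter> V) = fixed_part" using fixed_part_eq_proj assms(1) by simp
  show "convergent_mat_to (relaxed_proj U V \<mu>) (proj_matrix (U \<inter> V))"
    unfolding P by (rule convergent_to_fixed_part) (rule bounds)
  show "optimal_convergence_rate (relaxed_proj U V \<mu>) (proj_matrix (U \<inter> V)) (gamma_mat (relaxed_proj U V \<mu>))"
    unfolding P by (rule optimal_rate_gamma) (rule bounds)
qed

end

section \<open>Convergence and optimal rates\<close>

theorem theorem3p7:
  fixes U V :: "(real^'n) set" and p q s :: nat and \<theta> :: "nat \<Rightarrow> real"
  assumes "subspace U" and "subspace V"
    and "p = dim U" and "q = dim V" and "s = dim (U \<inter> V)"
    and "1 \<le> p" and "p \<le> q" and "q \<le> CARD('n) - 1"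
    and "principal_angles U V \<theta>"
  shows
    "(\<forall>\<mu>. relaxed_proj U V \<mu> = (1 - \<mu>) *\<^sub>R proj_matrix U + \<mu> *\<^sub>R (proj_matrix U ** proj_matrix V))
     \<and> (\<forall>\<mu>. s < p \<or> 0 \<le> \<mu> \<longrightarrow>
          (convergent_mat (relaxed_proj U V \<mu>)
             \<longleftrightarrow> ereal \<mu> \<in> {0..<2 / ereal ((sin (\<theta> p))\<^sup>2)}))
     \<and> (s < p \<longrightarrow>
          \<theta> (s + 1) = friedrichs_angle U V
        \<and> (\<forall>\<mu>\<in>{0<..2 / ((sin (\<theta> (s + 1)))\<^sup>2 + (sin (\<theta> p))\<^sup>2)}.
             convergent_mat_to (relaxed_proj U V \<mu>) (proj_matrix (U \<inter> V))
           \<and> optimal_convergence_rate (relaxed_proj U V \<mu>) (proj_matrix (U \<inter> V))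
               (gamma_mat (relaxed_proj U V \<mu>))
           \<and> gamma_mat (relaxed_proj U V \<mu>) = 1 - \<mu> * (sin (\<theta> (s + 1)))\<^sup>2)
        \<and> (\<forall>\<mu>\<in>{2 / ((sin (\<theta> (s + 1)))\<^sup>2 + (sin (\<theta> p))\<^sup>2)<..<2 / (sin (\<theta> p))\<^sup>2}.
             convergent_mat_to (relaxed_proj U V \<mu>) (proj_matrix (U \<inter> V))
           \<and> optimal_convergence_rate (relaxed_proj U V \<mu>) (proj_matrix (U \<inter> V))
               (gamma_mat (relaxed_proj U V \<mu>))
           \<and> gamma_mat (relaxed_proj U V \<mu>) = \<mu> * (sin (\<theta> p))\<^sup>2 - 1)
        \<and> (cos (\<theta> (s + 1)))\<^sup>2 = (friedrichs_cos U V)\<^sup>2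
        \<and> (\<forall>\<mu>. \<mu> \<noteq> 0 \<longrightarrow>
             ((convergent_mat_to (relaxed_proj U V \<mu>) (proj_matrix (U \<inter> V))
               \<and> (\<exists>r. optimal_convergence_rate (relaxed_proj U V \<mu>) (proj_matrix (U \<inter> V)) r
                      \<and> r < (cos (\<theta> (s + 1)))\<^sup>2))
              \<longleftrightarrow> \<mu> \<in> {1<..<(2 - (sin (\<theta> (s + 1)))\<^sup>2) / (sin (\<theta> p))\<^sup>2}))
        \<and> optimal_convergence_rate
             (relaxed_proj U V (2 / ((sin (\<theta> (s + 1)))\<^sup>2 + (sin (\<theta> p))\<^sup>2)))
             (proj_matrix (U \<inter> V))
             (((sin (\<theta> p))\<^sup>2 - (sin (\<theta> (s + 1)))\<^sup>2) / ((sin (\<theta> (s + 1)))\<^sup>2 + (sin (\<theta> p))\<^sup>2))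
        \<and> (\<forall>\<mu> L r. \<mu> \<noteq> 0 \<longrightarrow> convergence_rate (relaxed_proj U V \<mu>) L r \<longrightarrow>
             ((sin (\<theta> p))\<^sup>2 - (sin (\<theta> (s + 1)))\<^sup>2) / ((sin (\<theta> (s + 1)))\<^sup>2 + (sin (\<theta> p))\<^sup>2) \<le> r))"
proof -
  have min_dim: "min (dim U) (dim V) = p" using assms(3,4,7) by simp
  obtain u v where
    uv: "\<And>k. k \<in> {1..p} \<Longrightarrow> \<theta> k \<in> {0..pi/2} \<and> (u k, v k) \<in> principal_pairs U V u v k
        \<and> cos (\<theta> k) = u k \<bullet> v k \<and> (\<forall>(x, y) \<in> principal_pairs U V u v k. x \<bullet> y \<le> u k \<bullet> v k)"
    using assms(9) unfolding principal_angles_def min_dim by blast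
  interpret principal_vectors U V u v "dim U"
    by unfold_locales (use assms(1,2) uv \<open>p = dim U\<close> in auto)
  have S: "relaxed_projection U V u v" by (intro relaxed_projection.intro) unfold_locales
  define \<sigma> where "\<sigma> i = (sin (\<theta> i))\<^sup>2" for i
  have \<sigma>: "relaxed_projection.sin_sq u v i = \<sigma> i" if "i \<in> {1..p}" for i
    using uv[OF that] by (simp add: \<sigma>_def relaxed_projection.sin_sq_def[OF S] sin_squared_eq)
  have p: "p \<in> {1..p}" using \<open>1 \<le> p\<close> by simp
  have conv: "convergent_mat (relaxed_proj U V \<mu>) \<longleftrightarrow> 0 \<le> \<mu> \<and> \<mu> * \<sigma> p < 2" if "s < p \<or> 0 \<le> \<mu>" for \<mu>
    using relaxed_projection.convergent_relaxed_iff[OF S, of \<mu>] that assms(3,5,6) \<sigma>[OF p] by simp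
  have part1: "convergent_mat (relaxed_proj U V \<mu>) \<longleftrightarrow> ereal \<mu> \<in> {0..<2 / ereal (\<sigma> p)}"
    if "s < p \<or> 0 \<le> \<mu>" for \<mu>
  proof (cases "\<sigma> p = 0")
    \<comment> \<open>here \<open>2 / 0 = \<infinity>\<close> in the extended reals\<close>
    case True
    then show ?thesis unfolding conv[OF that] by (simp add: divide_ereal_def)
  next
    case False
    then have "0 < \<sigma> p" by (simp add: \<sigma>_def)
    then have "2 / ereal (\<sigma> p) = ereal (2 / \<sigma> p)" by (simp add: numeral_eq_ereal)
    then show ?thesis unfolding conv[OF that] using \<open>0 < \<sigma> p\<close> by (simp add: pos_less_divide_eq)
  qed
  have part2: "\<theta> (s + 1) = friedrichs_angle U V
        \<and> (\<forall>\<mu>\<in>{0<..2 / (\<sigma> (s + 1) + \<sigma> p)}.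
             convergent_mat_to (relaxed_proj U V \<mu>) (proj_matrix (U \<inter> V))
           \<and> optimal_convergence_rate (relaxed_proj U V \<mu>) (proj_matrix (U \<inter> V))
               (gamma_mat (relaxed_proj U V \<mu>))
           \<and> gamma_mat (relaxed_proj U V \<mu>) = 1 - \<mu> * \<sigma> (s + 1))
        \<and> (\<forall>\<mu>\<in>{2 / (\<sigma> (s + 1) + \<sigma> p)<..<2 / \<sigma> p}.
             convergent_mat_to (relaxed_proj U V \<mu>) (proj_matrix (U \<inter> V))
           \<and> optimal_convergence_rate (relaxed_proj U V \<mu>) (proj_matrix (U \<inter> V))
               (gamma_mat (relaxed_proj U V \<mu>))
           \<and> gamma_mat (relaxed_proj U V \<mu>) = \<mu> * \<sigma> p - 1)
        \<and> (cos (\<theta> (s + 1)))\<^sup>2 = (friedrichs_cos U V)\<^sup>2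
        \<and> (\<forall>\<mu>. \<mu> \<noteq> 0 \<longrightarrow>
             ((convergent_mat_to (relaxed_proj U V \<mu>) (proj_matrix (U \<inter> V))
               \<and> (\<exists>r. optimal_convergence_rate (relaxed_proj U V \<mu>) (proj_matrix (U \<inter> V)) r
                      \<and> r < (cos (\<theta> (s + 1)))\<^sup>2))
              \<longleftrightarrow> \<mu> \<in> {1<..<(2 - \<sigma> (s + 1)) / \<sigma> p}))
        \<and> optimal_convergence_rate (relaxed_proj U V (2 / (\<sigma> (s + 1) + \<sigma> p))) (proj_matrix (U \<inter> V))
             ((\<sigma> p - \<sigma> (s + 1)) / (\<sigma> (s + 1) + \<sigma> p))
        \<and> (\<forall>\<mu> L r. \<mu> \<noteq> 0 \<longrightarrow> convergence_rate (relaxed_proj U V \<mu>) L r \<longrightarrow>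
             (\<sigma> p - \<sigma> (s + 1)) / (\<sigma> (s + 1) + \<sigma> p) \<le> r)"
    if less: "s < p"
  proof -
    have s1: "s + 1 \<in> {1..p}" using less by simp
    define a b where "a = \<sigma> (s + 1)" and "b = \<sigma> p"
    have "0 < a"
      using relaxed_projection.sin_sq_eq_0_iff[OF S, of "s + 1"] s1 assms(3,5) \<sigma>[OF s1]
      by (auto simp: a_def \<sigma>_def)
    have "a \<le> b"
      using relaxed_projection.sin_sq_mono[OF S, of "s + 1" p] s1 p assms(3) \<sigma>[OF s1] \<sigma>[OF p]
      by (simp add: a_def b_def)
    have cos2: "(cos (\<theta> (s + 1)))\<^sup>2 = 1 - a" by (simp add: a_def \<sigma>_def cos_squared_eq)
    have cosF: "friedrichs_cos U V = cos (\<theta> (s + 1))"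
      using friedrichs_cos_eq less uv[OF s1] assms(3,5) by simp
    have angle: "\<theta> (s + 1) = friedrichs_angle U V"
    proof -
      have "0 \<le> \<theta> (s + 1)" "\<theta> (s + 1) \<le> pi" using uv[OF s1] pi_ge_zero by auto
      then show ?thesis unfolding friedrichs_angle_def cosF by (simp only: arccos_cos)
    qed
    have to_P: "convergent_mat_to (relaxed_proj U V \<mu>) (proj_matrix (U \<inter> V))"
      and optimal: "optimal_convergence_rate (relaxed_proj U V \<mu>) (proj_matrix (U \<inter> V)) (gamma_mat (relaxed_proj U V \<mu>))"
      if "0 < \<mu>" "\<mu> * b < 2" for \<mu>
      using relaxed_projection.relaxed_optimal_rate[OF S, of \<mu>] that less assms(3,5) \<sigma>[OF p]
      by (simp_all add: b_def)
    have gamma: "gamma_mat (relaxed_proj U V \<mu>) = max (1 - \<mu> * a) (\<mu> * b - 1)" if "0 < \<mu>" for \<mu>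
      using relaxed_projection.gamma_relaxed[OF S that] less assms(3,5) \<sigma>[OF p] \<sigma>[OF s1]
      by (simp add: a_def b_def)
    have range: "0 < \<mu> \<and> \<mu> * b < 2" if "convergent_mat_to (relaxed_proj U V \<mu>) L" "\<mu> \<noteq> 0" for \<mu> L
      using conv[of \<mu>] less that unfolding convergent_mat_def b_def by auto
    have small: "0 < \<mu> \<and> \<mu> * b < 2 \<and> gamma_mat (relaxed_proj U V \<mu>) = 1 - \<mu> * a"
      if "\<mu> \<in> {0<..2 / (a + b)}" for \<mu>
    proof -
      have "0 < \<mu>" "\<mu> * a + \<mu> * b \<le> 2" using that \<open>0 < a\<close> \<open>a \<le> b\<close> by (auto simp: field_simps)
      moreover have "0 < \<mu> * a" using \<open>0 < \<mu>\<close> \<open>0 < a\<close> by simp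
      ultimately show ?thesis using \<open>0 < \<mu>\<close> unfolding gamma[OF \<open>0 < \<mu>\<close>] by simp
    qed
    have large: "0 < \<mu> \<and> \<mu> * b < 2 \<and> gamma_mat (relaxed_proj U V \<mu>) = \<mu> * b - 1"
      if "\<mu> \<in> {2 / (a + b)<..<2 / b}" for \<mu>
    proof -
      have "0 < 2 / (a + b)" using \<open>0 < a\<close> \<open>a \<le> b\<close> by simp
      also have "\<dots> < \<mu>" using that by simp
      finally have "0 < \<mu>" .
      moreover have "\<mu> * a + \<mu> * b > 2" "\<mu> * b < 2" using that \<open>0 < a\<close> \<open>a \<le> b\<close> by (auto simp: field_simps)
      ultimately show ?thesis unfolding gamma[OF \<open>0 < \<mu>\<close>] by simp
    qed
    have better: "(convergent_mat_to (relaxed_proj U V \<mu>) (proj_matrix (U \<inter> V))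
               \<and> (\<exists>r. optimal_convergence_rate (relaxed_proj U V \<mu>) (proj_matrix (U \<inter> V)) r \<and> r < 1 - a))
              \<longleftrightarrow> \<mu> \<in> {1<..<(2 - a) / b}" if "\<mu> \<noteq> 0" for \<mu>
    proof
      assume l: "convergent_mat_to (relaxed_proj U V \<mu>) (proj_matrix (U \<inter> V))
               \<and> (\<exists>r. optimal_convergence_rate (relaxed_proj U V \<mu>) (proj_matrix (U \<inter> V)) r \<and> r < 1 - a)"
      then have \<mu>: "0 < \<mu>" "\<mu> * b < 2" using range[of \<mu>] \<open>\<mu> \<noteq> 0\<close> by auto
      have "gamma_mat (relaxed_proj U V \<mu>) < 1 - a"
        using l optimal_convergence_rate_unique[OF optimal[OF \<mu>]] by auto
      then have "a < \<mu> * a" "\<mu> * b < 2 - a" unfolding gamma[OF \<mu>(1)] by auto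
      then show "\<mu> \<in> {1<..<(2 - a) / b}"
        using \<open>0 < a\<close> \<open>a \<le> b\<close> by (simp add: pos_less_divide_eq)
    next
      assume "\<mu> \<in> {1<..<(2 - a) / b}"
      then have \<mu>: "1 < \<mu>" "\<mu> * b < 2 - a" using \<open>0 < a\<close> \<open>a \<le> b\<close> by (simp_all add: pos_less_divide_eq)
      then have \<mu>': "0 < \<mu>" "\<mu> * b < 2" using \<open>0 < a\<close> by auto
      have "a < \<mu> * a" using \<mu>(1) \<open>0 < a\<close> by simp
      then have "gamma_mat (relaxed_proj U V \<mu>) < 1 - a" unfolding gamma[OF \<mu>'(1)] using \<mu>(2) by simp
      then show "convergent_mat_to (relaxed_proj U V \<mu>) (proj_matrix (U \<inter> V))
               \<and> (\<exists>r. optimal_convergence_rate (relaxed_proj U V \<mu>) (proj_matrix (U \<inter> V)) r \<and> r < 1 - a)"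
        using to_P[OF \<mu>'] optimal[OF \<mu>'] by blast
    qed
    \<comment> \<open>the two branches of the rate meet at \<open>2 / (a + b)\<close>\<close>
    have ab: "0 < 2 / (a + b)" "1 - 2 / (a + b) * a = (b - a) / (a + b)" "2 / (a + b) * b - 1 = (b - a) / (a + b)"
      using \<open>0 < a\<close> \<open>a \<le> b\<close> by (simp_all add: field_simps)
    have best: "optimal_convergence_rate (relaxed_proj U V (2 / (a + b))) (proj_matrix (U \<inter> V)) ((b - a) / (a + b))"
      using optimal[of "2 / (a + b)"] small[of "2 / (a + b)"] ab(1) unfolding ab(2) by auto
    have lower: "(b - a) / (a + b) \<le> r" if "\<mu> \<noteq> 0" and rate: "convergence_rate (relaxed_proj U V \<mu>) L r" for \<mu> L r
    proof -
      have "0 < \<mu>" using range[OF convergence_rate_imp_convergent[OF rate] that(1)] by simp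
      interpret relaxed_projection U V u v \<mu> by (rule S)
      \<comment> \<open>the decreasing branch is above the crossing value to the left of \<open>2 / (a + b)\<close>, the increasing one to the right\<close>
      have "(b - a) / (a + b) \<le> max (1 - \<mu> * a) (\<mu> * b - 1)"
      proof (cases "\<mu> \<le> 2 / (a + b)")
        case True
        then have "\<mu> * a \<le> 2 / (a + b) * a" using \<open>0 < a\<close> by (intro mult_right_mono) auto
        then show ?thesis using ab(2) by linarith
      next
        case False
        then have "2 / (a + b) * b \<le> \<mu> * b" using \<open>0 < a\<close> \<open>a \<le> b\<close> by (intro mult_right_mono) auto
        then show ?thesis using ab(3) by linarith
      qed
      also have "\<dots> \<le> r" using convergence_rate_ge_gamma[OF rate] gamma[OF \<open>0 < \<mu>\<close>] by simp
      finally show ?thesis .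
    qed
    show ?thesis
      unfolding a_def[symmetric] b_def[symmetric] cosF cos2
    proof (intro conjI ballI allI impI)
      fix \<mu> assume \<mu>: "\<mu> \<in> {0<..2 / (a + b)}"
      show "convergent_mat_to (relaxed_proj U V \<mu>) (proj_matrix (U \<inter> V))"
        "optimal_convergence_rate (relaxed_proj U V \<mu>) (proj_matrix (U \<inter> V)) (gamma_mat (relaxed_proj U V \<mu>))"
        "gamma_mat (relaxed_proj U V \<mu>) = 1 - \<mu> * a"
        using small[OF \<mu>] to_P[of \<mu>] optimal[of \<mu>] by blast+
    next
      fix \<mu> assume \<mu>: "\<mu> \<in> {2 / (a + b)<..<2 / b}"
      show "convergent_mat_to (relaxed_proj U V \<mu>) (proj_matrix (U \<inter> V))"
        "optimal_convergence_rate (relaxed_proj U V \<mu>) (proj_matrix (U \<inter> V)) (gamma_mat (relaxed_proj U V \<mu>))"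
        "gamma_mat (relaxed_proj U V \<mu>) = \<mu> * b - 1"
        using large[OF \<mu>] to_P[of \<mu>] optimal[of \<mu>] by blast+
    qed (assumption | rule angle better best lower refl)+
  qed
  show ?thesis
    unfolding \<sigma>_def[symmetric]
    by (intro conjI allI impI relaxed_proj_eq part1 part2)
qed

end
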